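(* Let $p(x,\theta)=e^{\theta\cdot T(x)-\psi(\theta)}$ be a minimal $n$-dimensional exponential family, fix an observed datum $y$, and let $V$, $P$, $\theta'=P\theta$, $\bar\psi_y$, $\bar K_y$ be given by the dimension reduction of the conditional family (see context), with $m=\dim V$. There exists an $n\times n$ orthogonal matrix $Q$ such that for $\theta\in G=\mathrm{int}(\Theta)$ $$Q\,\nabla^2_{\theta\theta}\psi_y(\theta)\,Q^T=\begin{bmatrix}\nabla^2_{\theta'\theta'}\bar\psi_y(\theta')&0\\0&0\end{bmatrix},\qquad Q\theta=\begin{bmatrix}\theta'\\\theta''\end{bmatrix},\qquad\nabla^2_{\theta'\theta'}\bar\psi_y(\theta')\succ0,$$ and in particular $m=\dim(\theta')$ is the rank of $\nabla^2_{\theta\theta}\psi_y(\theta)$. The Kullback-Leibler divergence $K_y(\theta||\theta^+)$ depends only on the coordinates $\theta'=P\theta$, $\theta'^+=P\theta^+$, and is separating on the subspace $V=\mathrm{im}(P)$, i.e. $\bar K_y(\theta'||\theta'^+)=0$ implies $\theta'=\theta'^+$. Moreover $\nabla^2_{22}\bar K_y(\theta'||\theta')\succ0$.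
   Context: $X$ is a measurable space with $\sigma$-finite measure $\mu$; $h:X\to Y$ measurable, $\nu=\mu\circ h^{-1}$, $(\mu_y)_{y\in Y}$ a disintegration of $\mu$ with respect to $\nu$: each $\mu_y$ is concentrated on $h^{-1}(y)$ and $\int_Xf\,d\mu=\int_Y\int_{h^{-1}(y)}f\,d\mu_y\,d\nu(y)$. $T:X\to\mathbb R^n$ is measurable, $\psi(\theta)=\log\int_Xe^{\theta\cdot T}d\mu$, $\Theta=\{\theta\in\mathbb R^n:\int_Xe^{\theta\cdot T}d\mu<\infty\}$ of full dimension $n$. Minimality: no $a\ne0$ makes $a\cdot T(x)$ constant $\mu$-a.e. $q(y,\theta)=\int_{h^{-1}(y)}p(x,\theta)d\mu_y(x)$ (positive and finite on $\Theta$), $k(x|y,\theta)=p(x,\theta)/q(y,\theta)=e^{\theta\cdot T(x)-\psi_y(\theta)}$, $\psi_y(\theta)=\log\int_{h^{-1}(y)}e^{\theta\cdot T}d\mu_y$, and $K_y(\theta||\theta^+)=\int_{h^{-1}(y)}k(x|y,\theta)\log\frac{k(x|y,\theta)}{k(x|y,\theta^+)}d\mu_y(x)$. Dimension reduction: let $t_0+V$ ($V$ a linear subspace, $t_0\in V^\perp$) be the smallest affine subspace of $\mathbb R^n$ containing $T(x)$ for $\mu_y$-a.a. $x\in h^{-1}(y)$, $P$ the orthogonal projection onto $V$, $T'=P\circ T$, $\bar\psi_y(\theta')=\log\int_{h^{-1}(y)}e^{\theta'\cdot T'}d\mu_y$, $\bar k(x|y,\theta')=e^{\theta'\cdot T'(x)-\bar\psi_y(\theta')}$.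 Then $k(\cdot|y,\theta)d\mu_y=\bar k(\cdot|y,P\theta)d\mu_y$, and $\bar K_y(\theta'||\theta'^+)$ is the Kullback-Leibler divergence formed with $\bar k$. Here $\theta'\in V$ and $\theta''\in V^\perp$ are expressed in orthonormal coordinates of $V\cong\mathbb R^m$, $V^\perp\cong\mathbb R^{n-m}$; $\nabla^2_{22}$ is the Hessian with respect to the second argument. *)

theory Defs
  imports "HOL-Probability.Probability"
begin

text \<open>Concentration on the fibre over \<open>y\<close> is an almost-everywhere statement, so that no measurability
  of the fibres is needed; integrals over a fibre with respect to \<open>\<kappa> y\<close> are then integrals over the
  whole space.\<close>

definition disintegration ::
  "'x measure \<Rightarrow> 'y measure \<Rightarrow> ('x \<Rightarrow> 'y) \<Rightarrow> ('y \<Rightarrow> 'x measure) \<Rightarrow> bool" where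
  "disintegration M N h \<kappa> \<longleftrightarrow>
     (\<forall>y\<in>space N. sets (\<kappa> y) = sets M \<and> (AE x in \<kappa> y. h x = y)) \<and>
     (\<forall>f\<in>borel_measurable M.
        (\<lambda>y. \<integral>\<^sup>+x. f x \<partial>\<kappa> y) \<in> borel_measurable N \<and>
        (\<integral>\<^sup>+x. f x \<partial>M) = (\<integral>\<^sup>+y. (\<integral>\<^sup>+x. f x \<partial>\<kappa> y) \<partial>distr M N h))"

text \<open>With \<open>M\<close> instantiated by the reference measure, resp. by the fibre measure \<open>\<kappa> y\<close>, the function
  \<open>log_partition T M\<close> is \<open>\<psi>\<close>, resp. \<open>\<psi>\<^sub>y\<close>; with \<open>\<kappa> y\<close> and the projected statistic it
  is the reduced \<open>\<psi>\<^sub>y\<close>.\<close>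

definition natural_params :: "('x \<Rightarrow> 'a::euclidean_space) \<Rightarrow> 'x measure \<Rightarrow> 'a set" where
  "natural_params T M = {\<theta>. (\<integral>\<^sup>+x. ennreal (exp (\<theta> \<bullet> T x)) \<partial>M) < \<infinity>}"

definition log_partition :: "('x \<Rightarrow> 'a::euclidean_space) \<Rightarrow> 'x measure \<Rightarrow> 'a \<Rightarrow> real" where
  "log_partition T M \<theta> = ln (\<integral>x. exp (\<theta> \<bullet> T x) \<partial>M)"

definition exp_density :: "('x \<Rightarrow> 'a::euclidean_space) \<Rightarrow> 'x measure \<Rightarrow> 'a \<Rightarrow> 'x \<Rightarrow> real" where
  "exp_density T M \<theta> x = exp (\<theta> \<bullet> T x - log_partition T M \<theta>)"

definition minimal_statistic :: "('x \<Rightarrow> 'a::euclidean_space) \<Rightarrow> 'x measure \<Rightarrow> bool" where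
  "minimal_statistic T M \<longleftrightarrow> (\<forall>a. a \<noteq> 0 \<longrightarrow> \<not> (\<exists>c. AE x in M. a \<bullet> T x = c))"

definition marginal_density ::
  "('x \<Rightarrow> 'a::euclidean_space) \<Rightarrow> 'x measure \<Rightarrow> ('y \<Rightarrow> 'x measure) \<Rightarrow> 'y \<Rightarrow> 'a \<Rightarrow> real" where
  "marginal_density T M \<kappa> y \<theta> = (\<integral>x. exp_density T M \<theta> x \<partial>\<kappa> y)"

definition cond_density ::
  "('x \<Rightarrow> 'a::euclidean_space) \<Rightarrow> 'x measure \<Rightarrow> ('y \<Rightarrow> 'x measure) \<Rightarrow> 'y \<Rightarrow> 'a \<Rightarrow> 'x \<Rightarrow> real" where
  "cond_density T M \<kappa> y \<theta> x = exp_density T M \<theta> x / marginal_density T M \<kappa> y \<theta>"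

text \<open>Kullback-Leibler divergence of densities, as an extended Lebesgue integral: at boundary points
  of the parameter domain it may be infinite, where the Bochner integral would return 0.\<close>

definition kl_div :: "'x measure \<Rightarrow> ('x \<Rightarrow> real) \<Rightarrow> ('x \<Rightarrow> real) \<Rightarrow> ereal" where
  "kl_div M f g =
     enn2ereal (\<integral>\<^sup>+x. ennreal (f x * ln (f x / g x)) \<partial>M)
     - enn2ereal (\<integral>\<^sup>+x. ennreal (- (f x * ln (f x / g x))) \<partial>M)"

definition smallest_affine_support ::
  "('x \<Rightarrow> 'a::euclidean_space) \<Rightarrow> 'x measure \<Rightarrow> 'a set \<Rightarrow> bool" where
  "smallest_affine_support T M S \<longleftrightarrow>
     affine S \<and> (AE x in M. T x \<in> S) \<and> (\<forall>A. affine A \<and> (AE x in M. T x \<in> A) \<longrightarrow> S \<subseteq> A)"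

definition orth_proj :: "'a::euclidean_space set \<Rightarrow> 'a \<Rightarrow> 'a" where
  "orth_proj V x = (THE v. v \<in> V \<and> x - v \<in> V\<^sup>\<bottom>)"

definition orthonormal_coords :: "'a::euclidean_space set \<Rightarrow> (nat \<Rightarrow> 'a) \<Rightarrow> bool" where
  "orthonormal_coords V b \<longleftrightarrow>
     (\<forall>i<dim V. \<forall>j<dim V. b i \<bullet> b j = (if i = j then 1 else 0)) \<and>
     span (b ` {..<dim V}) = V"

lemma orthonormal_coords_exists:
  fixes V :: "'a::euclidean_space set"
  assumes "subspace V"
  shows "\<exists>b. orthonormal_coords V b"
proof -
  obtain B where B: "B \<subseteq> V" "pairwise orthogonal B" "\<And>x. x \<in> B \<Longrightarrow> norm x = 1"
      "independent B" "card B = dim V" "span B = V"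
    using orthonormal_basis_subspace[OF assms] by metis
  have "finite B" using B(4) by (rule independent_imp_finite)
  then obtain b where b: "bij_betw b {..<dim V} B"
    using ex_bij_betw_nat_finite[of B] B(5) by (auto simp: atLeast0LessThan)
  have "b i \<bullet> b j = (if i = j then 1 else 0)" if "i < dim V" "j < dim V" for i j
  proof -
    have m: "b i \<in> B" "b j \<in> B" using b that by (auto simp: bij_betw_def)
    show ?thesis
    proof (cases "i = j")
      case True
      then show ?thesis using B(3)[OF m(1)] by (simp add: norm_eq_1)
    next
      case False
      then have "b i \<noteq> b j" using b that by (auto simp: bij_betw_def inj_on_def)
      then show ?thesis using B(2) m False by (auto simp: pairwise_def orthogonal_def)
    qed
  qed
  moreover have "span (b ` {..<dim V}) = V" using b B(6) by (simp add: bij_betw_def)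
  ultimately show ?thesis unfolding orthonormal_coords_def by blast
qed

text \<open>In the two block constructions \<open>r\<close> gives the position (counted from 0) of each index of \<open>real^'n\<close>
  and the first block has size \<open>m\<close>, where \<open>m = 0\<close> and \<open>m = CARD('n)\<close> are allowed.\<close>

definition block_matrix :: "('n \<Rightarrow> nat) \<Rightarrow> nat \<Rightarrow> (nat \<Rightarrow> nat \<Rightarrow> real) \<Rightarrow> real^'n^'n" where
  "block_matrix r m A = (\<chi> i j. if r i < m \<and> r j < m then A (r i) (r j) else 0)"

definition block_vector :: "('n \<Rightarrow> nat) \<Rightarrow> nat \<Rightarrow> (nat \<Rightarrow> real) \<Rightarrow> (nat \<Rightarrow> real) \<Rightarrow> real^'n" where
  "block_vector r m u w = (\<chi> i. if r i < m then u (r i) else w (r i - m))"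

definition pos_def :: "nat \<Rightarrow> (nat \<Rightarrow> nat \<Rightarrow> real) \<Rightarrow> bool" where
  "pos_def m A \<longleftrightarrow>
     (\<forall>i<m. \<forall>j<m. A i j = A j i) \<and>
     (\<forall>u. (\<exists>i<m. u i \<noteq> 0) \<longrightarrow> 0 < (\<Sum>i<m. \<Sum>j<m. u i * A i j * u j))"

text \<open>\<open>f\<close>, considered as a function on the subspace \<open>V\<close> only, is twice differentiable at \<open>x\<close>, and
  \<open>H\<close> is its Hessian matrix in the coordinates of the orthonormal basis \<open>b i\<close> (\<open>i \<in> I\<close>) of \<open>V\<close>.
  Here \<open>g\<close> is a gradient field; only its component in \<open>V\<close> is determined, and only this
  component enters \<open>H\<close>.\<close>

definition has_hessian_on ::
  "'a::euclidean_space set \<Rightarrow> 'i set \<Rightarrow> ('i \<Rightarrow> 'a) \<Rightarrow> ('a \<Rightarrow> real) \<Rightarrow> ('i \<Rightarrow> 'i \<Rightarrow> real) \<Rightarrow> 'a \<Rightarrow> bool" where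
  "has_hessian_on V I b f H x \<longleftrightarrow>
     (\<exists>g G. (\<forall>\<^sub>F z in nhds x. z \<in> V \<longrightarrow> (f has_derivative (\<lambda>v. g z \<bullet> v)) (at z within V)) \<and>
            (g has_derivative G) (at x within V) \<and>
            (\<forall>i\<in>I. \<forall>j\<in>I. H i j = b i \<bullet> G (b j)))"

definition has_hessian :: "(real^'n \<Rightarrow> real) \<Rightarrow> real^'n^'n \<Rightarrow> real^'n \<Rightarrow> bool" where
  "has_hessian f H x \<longleftrightarrow> has_hessian_on UNIV UNIV (\<lambda>i. axis i 1) f (\<lambda>i j. H $ i $ j) x"

end

theory Submission
  imports Defs
begin

text \<open>Write \<open>\<nu> = \<kappa> y\<close> and \<open>S = P \<circ> T\<close>. Almost everywhere \<open>T = t\<^sub>0 + S\<close>, hence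
  \<open>\<psi>\<^sub>y z = z \<bullet> t\<^sub>0 + \<psi>bar (P z)\<close>, and everything reduces to the exponential family of \<open>S\<close> under \<open>\<nu>\<close>.
  On the interior of its natural parameter set its log-partition function may be differentiated twice
  under the integral, with gradient the mean and Hessian the covariance of \<open>S\<close> under the tilted
  measure. The quadratic form of the covariance at \<open>u \<in> V\<close> is a variance, which vanishes only if
  \<open>u \<bullet> T\<close> is constant almost everywhere; for \<open>u \<noteq> 0\<close> this would put \<open>T\<close> into a proper affine subspace
  of \<open>t\<^sub>0 + V\<close>. The divergence \<open>Kbar \<theta> \<eta>\<close> is \<open>\<psi>bar \<eta>\<close> plus an affine function of \<open>\<eta>\<close>, so it has the
  same Hessian in \<open>\<eta>\<close>.\<close>

section \<open>Differentiation under the integral\<close>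

lemma exp_remainder_le: "\<bar>exp s - 1 - s\<bar> \<le> s\<^sup>2 * exp \<bar>s\<bar>" for s :: real
proof -
  obtain t where t: "\<bar>t\<bar> \<le> \<bar>s\<bar>" "exp s = (\<Sum>k<2. s ^ k / fact k) + exp t / fact 2 * s ^ 2"
    using Maclaurin_exp_le by blast
  have "exp s - 1 - s = exp t / 2 * s\<^sup>2"
    using t(2) by (simp add: numeral_2_eq_2)
  also have "\<bar>\<dots>\<bar> = exp t * s\<^sup>2 / 2" by (simp add: abs_mult)
  also have "\<dots> \<le> exp t * s\<^sup>2" by simp
  also have "\<dots> \<le> exp \<bar>s\<bar> * s\<^sup>2"
    using t(1) by (intro mult_right_mono) auto
  finally show ?thesis by (simp add: mult.commute)
qed

lemma le_exp_times:
  fixes x d :: real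
  assumes "0 \<le> x" "0 < d"
  shows "x \<le> exp (d * x) / d"
proof -
  have "d * x \<le> exp (d * x)" using exp_ge_add_one_self[of "d * x"] by linarith
  then show ?thesis using assms by (simp add: field_simps)
qed

lemma power2_le_exp_times:
  fixes x d :: real
  assumes "0 \<le> x" "0 < d"
  shows "x\<^sup>2 \<le> 2 / d\<^sup>2 * exp (d * x)"
proof -
  have "(d * x)\<^sup>2 / 2 \<le> exp (d * x)"
    using exp_lower_Taylor_quadratic[of "d * x"] mult_nonneg_nonneg[of d x] assms by linarith
  then show ?thesis using assms by (simp add: field_simps)
qed

text \<open>The Euclidean norm is at most the sum of the absolute coordinates, hence at most
  \<open>DIM('a)\<close> times the largest one. This trades the norm for finitely many linear
  functionals, the exponents that membership in \<open>natural_params\<close> controls.\<close>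

lemma exp_norm_le_sum:
  fixes s :: "'a::euclidean_space"
  assumes "0 \<le> d"
  shows "exp (d * norm s) \<le> (\<Sum>i\<in>Basis. exp (real DIM('a) * d * (s \<bullet> i)) + exp (- (real DIM('a) * d * (s \<bullet> i))))"
proof -
  define m where "m = Max ((\<lambda>i. \<bar>s \<bullet> i\<bar>) ` Basis)"
  have "m \<in> (\<lambda>i. \<bar>s \<bullet> i\<bar>) ` Basis"
    unfolding m_def by (intro Max_in) auto
  moreover have "\<bar>s \<bullet> i\<bar> \<le> m" if "i \<in> Basis" for i
    unfolding m_def using that by (intro Max_ge) auto
  ultimately obtain j where j: "j \<in> Basis" "\<And>i. i \<in> Basis \<Longrightarrow> \<bar>s \<bullet> i\<bar> \<le> \<bar>s \<bullet> j\<bar>"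
    by auto
  have "norm s \<le> (\<Sum>i\<in>Basis. \<bar>s \<bullet> i\<bar>)" by (rule norm_le_l1)
  also have "\<dots> \<le> (\<Sum>i\<in>(Basis::'a set). \<bar>s \<bullet> j\<bar>)" by (intro sum_mono j(2))
  finally have "d * norm s \<le> d * (real DIM('a) * \<bar>s \<bullet> j\<bar>)"
    using assms by (intro mult_left_mono) auto
  then have "exp (d * norm s) \<le> exp \<bar>real DIM('a) * d * (s \<bullet> j)\<bar>"
    using assms by (simp add: abs_mult mult_ac)
  also have "\<dots> \<le> exp (real DIM('a) * d * (s \<bullet> j)) + exp (- (real DIM('a) * d * (s \<bullet> j)))"
    by (simp add: abs_real_def)
  also have "\<dots> \<le> (\<Sum>i\<in>Basis. exp (real DIM('a) * d * (s \<bullet> i)) + exp (- (real DIM('a) * d * (s \<bullet> i))))"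
    using j(1) by (intro member_le_sum) (auto intro: add_nonneg_nonneg)
  finally show ?thesis .
qed

section \<open>Integrability of exponential tilts and their derivatives in the parameter\<close>

lemma natural_params_iff_integrable:
  assumes "S \<in> borel_measurable M"
  shows "\<theta> \<in> natural_params S M \<longleftrightarrow> integrable M (\<lambda>x. exp (\<theta> \<bullet> S x))"
  using assms by (simp add: natural_params_def integrable_iff_bounded)

text \<open>Some coordinate dominates \<open>norm (S x)\<close> up to the factor \<open>DIM('a)\<close>, so \<open>exp (d * norm (S x))\<close> is
  dominated by the exponential tilts in the directions \<open>\<plusminus>i\<close> with \<open>i \<in> Basis\<close>.\<close>

lemma integrable_exp_norm:
  fixes S :: "'x \<Rightarrow> 'a::euclidean_space"
  assumes [measurable]: "S \<in> borel_measurable M" and z: "z \<in> interior (natural_params S M)"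
  obtains d where "0 < d" "integrable M (\<lambda>x. exp (z \<bullet> S x + d * norm (S x)))"
proof -
  obtain e where e: "0 < e" "cball z e \<subseteq> natural_params S M"
    using z mem_interior_cball by blast
  \<comment> \<open>With this \<open>d\<close> the tilts produced by \<open>exp_norm_le_sum\<close>
    have length exactly \<open>e\<close>, so the shifted parameters stay in the ball.\<close>
  define d where "d = e / real DIM('a)"
  have d: "0 < d" "real DIM('a) * d = e" using e by (auto simp: d_def)
  have int: "integrable M (\<lambda>x. exp (z \<bullet> S x + e * (S x \<bullet> i)))"
      "integrable M (\<lambda>x. exp (z \<bullet> S x - e * (S x \<bullet> i)))" if "i \<in> Basis" for i
  proof -
    have "z + e *\<^sub>R i \<in> natural_params S M" "z - e *\<^sub>R i \<in> natural_params S M"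
      using e that by (auto intro!: subsetD[OF e(2)] simp: dist_norm)
    then show "integrable M (\<lambda>x. exp (z \<bullet> S x + e * (S x \<bullet> i)))"
      "integrable M (\<lambda>x. exp (z \<bullet> S x - e * (S x \<bullet> i)))"
      by (simp_all add: natural_params_iff_integrable algebra_simps inner_commute)
  qed
  have "integrable M (\<lambda>x. \<Sum>i\<in>Basis. exp (z \<bullet> S x + e * (S x \<bullet> i)) + exp (z \<bullet> S x - e * (S x \<bullet> i)))"
    using int by (intro Bochner_Integration.integrable_sum Bochner_Integration.integrable_add)
  then have "integrable M (\<lambda>x. exp (z \<bullet> S x + d * norm (S x)))"
  proof (rule Bochner_Integration.integrable_bound)
    show "AE x in M. norm (exp (z \<bullet> S x + d * norm (S x))) \<le>
        norm (\<Sum>i\<in>Basis. exp (z \<bullet> S x + e * (S x \<bullet> i)) + exp (z \<bullet> S x - e * (S x \<bullet> i)))"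
    proof (rule AE_I2)
      fix x
      have "exp (z \<bullet> S x + d * norm (S x)) \<le> exp (z \<bullet> S x) *
          (\<Sum>i\<in>Basis. exp (e * (S x \<bullet> i)) + exp (- (e * (S x \<bullet> i))))"
        using exp_norm_le_sum[of d "S x"] d by (simp add: exp_add)
      also have "\<dots> = (\<Sum>i\<in>Basis. exp (z \<bullet> S x + e * (S x \<bullet> i)) + exp (z \<bullet> S x - e * (S x \<bullet> i)))"
        by (simp add: sum_distrib_left exp_add exp_diff exp_minus field_simps)
      finally show "norm (exp (z \<bullet> S x + d * norm (S x))) \<le>
        norm (\<Sum>i\<in>Basis. exp (z \<bullet> S x + e * (S x \<bullet> i)) + exp (z \<bullet> S x - e * (S x \<bullet> i)))"
        by simp
    qed
  qed measurable
  with d(1) show thesis by (rule that)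
qed

lemma integrable_exp_le:
  fixes S :: "'x \<Rightarrow> 'a::euclidean_space" and w :: "'x \<Rightarrow> 'b::euclidean_space"
  assumes "integrable M (\<lambda>x. exp (z \<bullet> S x + d * norm (S x)))"
    and [measurable]: "S \<in> borel_measurable M" "w \<in> borel_measurable M"
    and "\<And>x. norm (w x) \<le> C * exp (d * norm (S x))"
  shows "integrable M (\<lambda>x. exp (z \<bullet> S x) *\<^sub>R w x)"
proof (rule Bochner_Integration.integrable_bound)
  show "integrable M (\<lambda>x. C * exp (z \<bullet> S x + d * norm (S x)))" using assms(1) by simp
  show "AE x in M. norm (exp (z \<bullet> S x) *\<^sub>R w x) \<le> norm (C * exp (z \<bullet> S x + d * norm (S x)))"
  proof (rule AE_I2)
    fix x
    have "norm (exp (z \<bullet> S x) *\<^sub>R w x) \<le> exp (z \<bullet> S x) * (C * exp (d * norm (S x)))"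
      using assms(4) by simp
    \<comment> \<open>The sign of \<open>C\<close> is left open, hence the passage to the absolute
      value.\<close>
    also have "\<dots> \<le> \<bar>exp (z \<bullet> S x) * (C * exp (d * norm (S x)))\<bar>" by (rule abs_ge_self)
    finally show "norm (exp (z \<bullet> S x) *\<^sub>R w x) \<le> norm (C * exp (z \<bullet> S x + d * norm (S x)))"
      by (simp add: exp_add mult_ac)
  qed
qed measurable

text \<open>Expanding the tilt \<open>exp (v \<bullet> S x)\<close> to first order leaves a
  remainder whose integral is quadratic in \<open>norm v\<close>. The weight \<open>w\<close> may
  grow subexponentially in \<open>norm (S x)\<close>: \<open>w = 1\<close> yields the derivative of
  the partition function and \<open>w = S\<close> that of the first moment.\<close>

lemma has_derivative_exp_integral:
  fixes S :: "'x \<Rightarrow> 'a::euclidean_space" and w :: "'x \<Rightarrow> 'b::euclidean_space"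
  assumes [measurable]: "S \<in> borel_measurable M" "w \<in> borel_measurable M"
    and z: "z \<in> interior (natural_params S M)"
    and w: "\<And>e. 0 < e \<Longrightarrow> \<exists>C. \<forall>x. norm (w x) \<le> C * exp (e * norm (S x))"
  shows "((\<lambda>z. \<integral>x. exp (z \<bullet> S x) *\<^sub>R w x \<partial>M) has_derivative
          (\<lambda>v. \<integral>x. exp (z \<bullet> S x) *\<^sub>R ((v \<bullet> S x) *\<^sub>R w x) \<partial>M)) (at z)"
proof -
  obtain d where d: "0 < d" and int: "integrable M (\<lambda>x. exp (z \<bullet> S x + d * norm (S x)))"
    using integrable_exp_norm[OF assms(1) z] .
  \<comment> \<open>The exponent \<open>d\<close> is split into three equal shares: one for the
    growth of \<open>w\<close>, one for a polynomial factor in \<open>norm (S x)\<close>, one for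
    \<open>exp \<bar>v \<bullet> S x\<bar>\<close> in the Taylor remainder.\<close>
  define e where "e = d / 3"
  have e: "0 < e" "e + (e + e) = d" using d by (auto simp: e_def)
  obtain C where C: "\<And>x. norm (w x) \<le> C * exp (e * norm (S x))" using w e by blast
  \<comment> \<open>Here \<open>c\<close> stands for the polynomial factor; \<open>C1\<close> below
    is the variant in which the third share is not spent.\<close>
  have C': "norm (w x) * c * exp (e * norm (S x)) \<le> (C * c0) * exp (d * norm (S x))"
    if "c \<le> c0 * exp (e * norm (S x))" "0 \<le> c" for c c0 x
  proof -
    have "0 \<le> C * exp (e * norm (S x))" using C norm_ge_zero order_trans by blast
    then have "norm (w x) * c * exp (e * norm (S x)) \<le>
        (C * exp (e * norm (S x))) * (c0 * exp (e * norm (S x))) * exp (e * norm (S x))"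
      using that C by (intro mult_mono) auto
    also have "\<dots> = C * c0 * exp ((e + (e + e)) * norm (S x))"
      unfolding exp_add distrib_right by (simp add: mult_ac)
    finally show ?thesis using e by simp
  qed
  have expn: "1 \<le> exp (e * norm (S x))" for x using e by simp
  have C1: "norm (w x) * c \<le> (C * c0) * exp (d * norm (S x))"
    if "c \<le> c0 * exp (e * norm (S x))" "0 \<le> c" for c c0 x
    using C'[OF that] mult_left_mono[OF expn, of "norm (w x) * c" x] that by simp
  \<comment> \<open>The first-order Taylor remainder of the tilt, carrying the weight
    \<open>w\<close>.\<close>
  define R where "R v x = (exp (v \<bullet> S x) - 1 - v \<bullet> S x) *\<^sub>R w x" for v x
  have [measurable]: "R v \<in> borel_measurable M" for v unfolding R_def by measurable
  have Rle: "norm (R v x) \<le> (norm v)\<^sup>2 * (C * (2 / e\<^sup>2)) * exp (d * norm (S x))"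
    if v: "norm v \<le> e" for v x
  proof -
    have vS: "\<bar>v \<bullet> S x\<bar> \<le> norm v * norm (S x)" by (rule Cauchy_Schwarz_ineq2)
    have "norm (R v x) \<le> ((v \<bullet> S x)\<^sup>2 * exp \<bar>v \<bullet> S x\<bar>) * norm (w x)"
      unfolding R_def using exp_remainder_le by (auto intro: mult_right_mono)
    also have "\<dots> \<le> ((norm v * norm (S x))\<^sup>2 * exp (e * norm (S x))) * norm (w x)"
    proof (intro mult_right_mono mult_mono)
      show "(v \<bullet> S x)\<^sup>2 \<le> (norm v * norm (S x))\<^sup>2" using power_mono[OF vS abs_ge_zero, of 2] by simp
      show "exp \<bar>v \<bullet> S x\<bar> \<le> exp (e * norm (S x))"
        using order_trans[OF vS mult_right_mono[OF v]] by simp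
    qed auto
    also have "\<dots> = (norm v)\<^sup>2 * (norm (w x) * (norm (S x))\<^sup>2 * exp (e * norm (S x)))"
      by (simp add: power_mult_distrib mult_ac)
    also have "\<dots> \<le> (norm v)\<^sup>2 * (C * (2 / e\<^sup>2) * exp (d * norm (S x)))"
      using e by (intro mult_left_mono C' power2_le_exp_times) auto
    finally show ?thesis by (simp add: mult_ac)
  qed
  have int_w: "integrable M (\<lambda>x. exp (z \<bullet> S x) *\<^sub>R w x)"
    using C1[of 1 1] expn by (intro integrable_exp_le[OF int, where C = C]) auto
  have int_Sw: "integrable M (\<lambda>x. exp (z \<bullet> S x) *\<^sub>R ((v \<bullet> S x) *\<^sub>R w x))" for v
  proof (rule integrable_exp_le[OF int, where C = "C * (norm v / e)"])
    fix x
    have "\<bar>v \<bullet> S x\<bar> \<le> norm v * norm (S x)" by (rule Cauchy_Schwarz_ineq2)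
    also have "\<dots> \<le> norm v * (exp (e * norm (S x)) / e)"
      using e by (intro mult_left_mono le_exp_times) auto
    finally show "norm ((v \<bullet> S x) *\<^sub>R w x) \<le> C * (norm v / e) * exp (d * norm (S x))"
      using C1[of "\<bar>v \<bullet> S x\<bar>" "norm v / e" x] by (simp add: mult_ac)
  qed measurable
  have int_R: "integrable M (\<lambda>x. exp (z \<bullet> S x) *\<^sub>R R v x)" if "norm v \<le> e" for v
    by (rule integrable_exp_le[OF int _ _ Rle[OF that]]) measurable
  have dec: "exp ((z + v) \<bullet> S x) *\<^sub>R w x =
      exp (z \<bullet> S x) *\<^sub>R w x + exp (z \<bullet> S x) *\<^sub>R ((v \<bullet> S x) *\<^sub>R w x) + exp (z \<bullet> S x) *\<^sub>R R v x" for v x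
    by (simp add: R_def inner_add_left exp_add scaleR_diff_left scaleR_diff_right)
  define K where "K = (C * (2 / e\<^sup>2)) * (\<integral>x. exp (z \<bullet> S x + d * norm (S x)) \<partial>M)"
  have R_norm: "norm (\<integral>x. exp (z \<bullet> S x) *\<^sub>R R v x \<partial>M) \<le> (norm v)\<^sup>2 * K" if v: "norm v \<le> e" for v
  proof -
    have "norm (\<integral>x. exp (z \<bullet> S x) *\<^sub>R R v x \<partial>M) \<le>
        (\<integral>x. ((norm v)\<^sup>2 * (C * (2 / e\<^sup>2))) * exp (z \<bullet> S x + d * norm (S x)) \<partial>M)"
      using int int_R[OF v]
    proof (intro order_trans[OF integral_norm_bound] integral_mono)
      fix x
      show "norm (exp (z \<bullet> S x) *\<^sub>R R v x) \<le>
          ((norm v)\<^sup>2 * (C * (2 / e\<^sup>2))) * exp (z \<bullet> S x + d * norm (S x))"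
        using mult_left_mono[OF Rle[OF v], of "exp (z \<bullet> S x)" x] by (simp add: exp_add mult_ac)
    qed (auto intro: int_R[OF v] simp del: norm_scaleR)
    also have "\<dots> = (norm v)\<^sup>2 * K"
      unfolding K_def by (subst integral_mult_right_zero) (rule mult.assoc)
    finally show ?thesis .
  qed
  have diff3: "p = a + b + c \<Longrightarrow> p - a - b = c" for p a b c :: 'b
    by simp
  \<comment> \<open>Divided by \<open>norm (y - z)\<close>, the integrated remainder is squeezed
    between 0 and a bound linear in that norm.\<close>
  show ?thesis
  proof (rule has_derivativeI_sandwich[OF e(1), where H = "\<lambda>y. norm (y - z) * K"])
    have "linear (\<lambda>v. \<integral>x. exp (z \<bullet> S x) *\<^sub>R ((v \<bullet> S x) *\<^sub>R w x) \<partial>M)"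
    proof (rule linearI)
      fix u v
      show "(\<integral>x. exp (z \<bullet> S x) *\<^sub>R (((u + v) \<bullet> S x) *\<^sub>R w x) \<partial>M) =
          (\<integral>x. exp (z \<bullet> S x) *\<^sub>R ((u \<bullet> S x) *\<^sub>R w x) \<partial>M) + (\<integral>x. exp (z \<bullet> S x) *\<^sub>R ((v \<bullet> S x) *\<^sub>R w x) \<partial>M)"
        using Bochner_Integration.integral_add[OF int_Sw[of u] int_Sw[of v]]
        by (simp only: inner_add_left scaleR_add_left scaleR_add_right)
    next
      fix c :: real and v
      show "(\<integral>x. exp (z \<bullet> S x) *\<^sub>R (((c *\<^sub>R v) \<bullet> S x) *\<^sub>R w x) \<partial>M) =
          c *\<^sub>R (\<integral>x. exp (z \<bullet> S x) *\<^sub>R ((v \<bullet> S x) *\<^sub>R w x) \<partial>M)"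
        by (subst integral_scaleR_right[symmetric]) (simp add: mult_ac)
    qed
    then show "bounded_linear (\<lambda>v. \<integral>x. exp (z \<bullet> S x) *\<^sub>R ((v \<bullet> S x) *\<^sub>R w x) \<partial>M)"
      by (simp add: linear_conv_bounded_linear)
    show "((\<lambda>y. norm (y - z) * K) \<longlongrightarrow> 0) (at z)"
      by (auto intro!: tendsto_eq_intros)
  next
    fix y assume y: "y \<noteq> z" "dist y z < e"
    define v where "v = y - z"
    have v: "norm v \<le> e" "v \<noteq> 0" "y = z + v" using y by (auto simp: v_def dist_norm)
    have "(\<integral>x. exp (y \<bullet> S x) *\<^sub>R w x \<partial>M) = (\<integral>x. exp (z \<bullet> S x) *\<^sub>R w x
        + exp (z \<bullet> S x) *\<^sub>R ((v \<bullet> S x) *\<^sub>R w x) + exp (z \<bullet> S x) *\<^sub>R R v x \<partial>M)"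
      unfolding v(3) dec ..
    also have "\<dots> = (\<integral>x. exp (z \<bullet> S x) *\<^sub>R w x
        + exp (z \<bullet> S x) *\<^sub>R ((v \<bullet> S x) *\<^sub>R w x) \<partial>M) + (\<integral>x. exp (z \<bullet> S x) *\<^sub>R R v x \<partial>M)"
      by (intro Bochner_Integration.integral_add Bochner_Integration.integrable_add int_w int_Sw int_R v(1))
    also have "(\<integral>x. exp (z \<bullet> S x) *\<^sub>R w x + exp (z \<bullet> S x) *\<^sub>R ((v \<bullet> S x) *\<^sub>R w x) \<partial>M) =
        (\<integral>x. exp (z \<bullet> S x) *\<^sub>R w x \<partial>M) + (\<integral>x. exp (z \<bullet> S x) *\<^sub>R ((v \<bullet> S x) *\<^sub>R w x) \<partial>M)"
      by (intro Bochner_Integration.integral_add int_w int_Sw)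
    finally have eq: "(\<integral>x. exp (y \<bullet> S x) *\<^sub>R w x \<partial>M) - (\<integral>x. exp (z \<bullet> S x) *\<^sub>R w x \<partial>M)
        - (\<integral>x. exp (z \<bullet> S x) *\<^sub>R ((v \<bullet> S x) *\<^sub>R w x) \<partial>M) = (\<integral>x. exp (z \<bullet> S x) *\<^sub>R R v x \<partial>M)"
      by (rule diff3)
    have "norm (\<integral>x. exp (z \<bullet> S x) *\<^sub>R R v x \<partial>M) / norm v \<le> (norm v)\<^sup>2 * K / norm v"
      using R_norm[OF v(1)] by (rule divide_right_mono) simp
    also have "\<dots> = norm v * K" using v(2) by (simp add: power2_eq_square)
    finally show "norm ((\<integral>x. exp (y \<bullet> S x) *\<^sub>R w x \<partial>M) - (\<integral>x. exp (z \<bullet> S x) *\<^sub>R w x \<partial>M)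
        - (\<integral>x. exp (z \<bullet> S x) *\<^sub>R (((y - z) \<bullet> S x) *\<^sub>R w x) \<partial>M)) / norm (y - z) \<le> norm (y - z) * K"
      unfolding v_def[symmetric] eq .
  qed
qed

section \<open>Tilted mean and covariance\<close>

definition tilted_mean :: "('x \<Rightarrow> 'a::euclidean_space) \<Rightarrow> 'x measure \<Rightarrow> 'a \<Rightarrow> 'a" where
  "tilted_mean S M z = (\<integral>x. exp (z \<bullet> S x) *\<^sub>R S x \<partial>M) /\<^sub>R (\<integral>x. exp (z \<bullet> S x) \<partial>M)"

text \<open>The covariance under the normalised tilted measure, as an operator acting on
  \<open>v\<close> rather than as a matrix; in this form it can itself be the derivative of
  \<open>tilted_mean\<close>. The centred integrand makes its quadratic form visibly a
  variance.\<close>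

definition tilted_cov :: "('x \<Rightarrow> 'a::euclidean_space) \<Rightarrow> 'x measure \<Rightarrow> 'a \<Rightarrow> 'a \<Rightarrow> 'a" where
  "tilted_cov S M z v =
     (\<integral>x. exp (z \<bullet> S x) *\<^sub>R ((v \<bullet> (S x - tilted_mean S M z)) *\<^sub>R (S x - tilted_mean S M z)) \<partial>M)
       /\<^sub>R (\<integral>x. exp (z \<bullet> S x) \<partial>M)"

text \<open>Excluding the null measure makes the partition function positive on
  \<open>natural_params S M\<close>, so that \<open>exp\<close> undoes the logarithm in
  \<open>log_partition\<close> there.\<close>

locale exp_family =
  fixes S :: "'x \<Rightarrow> 'a::euclidean_space" and M :: "'x measure"
  assumes measurable_S[measurable]: "S \<in> borel_measurable M"
    and nontrivial: "emeasure M (space M) \<noteq> 0"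
begin

abbreviation partition_function :: "'a \<Rightarrow> real" where
  "partition_function z \<equiv> \<integral>x. exp (z \<bullet> S x) \<partial>M"

lemma integrable_exp: "z \<in> natural_params S M \<Longrightarrow> integrable M (\<lambda>x. exp (z \<bullet> S x))"
  by (simp add: natural_params_iff_integrable)

lemma partition_function_pos:
  assumes "z \<in> natural_params S M"
  shows "0 < partition_function z"
proof (rule ccontr)
  assume "\<not> 0 < partition_function z"
  moreover have "0 \<le> partition_function z" by (intro integral_nonneg_AE) auto
  ultimately have "partition_function z = 0" by simp
  then have "AE x in M. exp (z \<bullet> S x) = 0"
    using integral_nonneg_eq_0_iff_AE[OF integrable_exp[OF assms]] by simp
  then show False using nontrivial by (simp add: AE_iff_null null_sets_def)
qed

text \<open>Linear and quadratic factors are absorbed into \<open>exp (d * norm (S x))\<close>,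
  whose tilt is integrable at interior points.\<close>

lemma integrable_moments:
  assumes "z \<in> interior (natural_params S M)"
  shows "integrable M (\<lambda>x. exp (z \<bullet> S x) *\<^sub>R S x)"
    and "integrable M (\<lambda>x. exp (z \<bullet> S x) *\<^sub>R ((v \<bullet> S x) *\<^sub>R S x))"
proof -
  obtain d where d: "0 < d" and int: "integrable M (\<lambda>x. exp (z \<bullet> S x + d * norm (S x)))"
    using integrable_exp_norm[OF measurable_S assms] .
  show "integrable M (\<lambda>x. exp (z \<bullet> S x) *\<^sub>R S x)"
    using le_exp_times[of "norm (S _)" d] d by (intro integrable_exp_le[OF int, where C = "1 / d"]) auto
  show "integrable M (\<lambda>x. exp (z \<bullet> S x) *\<^sub>R ((v \<bullet> S x) *\<^sub>R S x))"
  proof (rule integrable_exp_le[OF int, where C = "norm v * (2 / d\<^sup>2)"])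
    fix x
    have "norm ((v \<bullet> S x) *\<^sub>R S x) \<le> (norm v * norm (S x)) * norm (S x)"
      using Cauchy_Schwarz_ineq2[of v "S x"] by (simp add: mult_right_mono)
    also have "\<dots> = norm v * (norm (S x))\<^sup>2" by (simp add: power2_eq_square)
    also have "\<dots> \<le> norm v * (2 / d\<^sup>2 * exp (d * norm (S x)))"
      using d by (intro mult_left_mono power2_le_exp_times) auto
    finally show "norm ((v \<bullet> S x) *\<^sub>R S x) \<le> norm v * (2 / d\<^sup>2) * exp (d * norm (S x))"
      by (simp only: mult.assoc)
  qed measurable
qed

lemma integrable_cov:
  assumes "z \<in> interior (natural_params S M)"
  shows "integrable M (\<lambda>x. exp (z \<bullet> S x) *\<^sub>R ((v \<bullet> (S x - m)) *\<^sub>R (S x - m)))"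
proof -
  note z = interior_subset[THEN subsetD, OF assms]
  have "integrable M (\<lambda>x. exp (z \<bullet> S x) *\<^sub>R ((v \<bullet> S x) *\<^sub>R S x) - (exp (z \<bullet> S x) *\<^sub>R S x \<bullet> v) *\<^sub>R m
      - (v \<bullet> m) *\<^sub>R (exp (z \<bullet> S x) *\<^sub>R S x) + exp (z \<bullet> S x) *\<^sub>R ((v \<bullet> m) *\<^sub>R m))"
    by (intro Bochner_Integration.integrable_add Bochner_Integration.integrable_diff
        integrable_scaleR_left integrable_scaleR_right integrable_inner_left integrable_moments
        assms integrable_exp z)
  moreover have "exp (z \<bullet> S x) *\<^sub>R ((v \<bullet> (S x - m)) *\<^sub>R (S x - m)) =
      exp (z \<bullet> S x) *\<^sub>R ((v \<bullet> S x) *\<^sub>R S x) - (exp (z \<bullet> S x) *\<^sub>R S x \<bullet> v) *\<^sub>R m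
      - (v \<bullet> m) *\<^sub>R (exp (z \<bullet> S x) *\<^sub>R S x) + exp (z \<bullet> S x) *\<^sub>R ((v \<bullet> m) *\<^sub>R m)" for x
    by (simp add: algebra_simps inner_commute)
  ultimately show ?thesis by simp
qed

text \<open>Second moment minus product of means: this is the form in which the product rule
  delivers the derivative of \<open>tilted_mean\<close>, whereas the centred form shows
  positivity.\<close>

lemma tilted_cov_eq:
  assumes "z \<in> interior (natural_params S M)"
  shows "tilted_cov S M z v =
    (\<integral>x. exp (z \<bullet> S x) *\<^sub>R ((v \<bullet> S x) *\<^sub>R S x) \<partial>M) /\<^sub>R partition_function z
      - (v \<bullet> tilted_mean S M z) *\<^sub>R tilted_mean S M z"
proof -
  note z = interior_subset[THEN subsetD, OF assms]
  define m where "m = tilted_mean S M z"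
  have F: "partition_function z \<noteq> 0" using partition_function_pos[OF z] by simp
  then have m: "(\<integral>x. exp (z \<bullet> S x) *\<^sub>R S x \<partial>M) = partition_function z *\<^sub>R m"
    by (simp add: m_def tilted_mean_def)
  note int = integrable_moments[OF assms] integrable_exp[OF z]
  have "(\<integral>x. exp (z \<bullet> S x) *\<^sub>R ((v \<bullet> (S x - m)) *\<^sub>R (S x - m)) \<partial>M) =
    (\<integral>x. exp (z \<bullet> S x) *\<^sub>R ((v \<bullet> S x) *\<^sub>R S x) - (exp (z \<bullet> S x) *\<^sub>R S x \<bullet> v) *\<^sub>R m
      - (v \<bullet> m) *\<^sub>R (exp (z \<bullet> S x) *\<^sub>R S x) + exp (z \<bullet> S x) *\<^sub>R ((v \<bullet> m) *\<^sub>R m) \<partial>M)"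
    by (intro Bochner_Integration.integral_cong refl)
      (simp add: algebra_simps inner_commute)
  also have "\<dots> = (\<integral>x. exp (z \<bullet> S x) *\<^sub>R ((v \<bullet> S x) *\<^sub>R S x) \<partial>M)
      - ((\<integral>x. exp (z \<bullet> S x) *\<^sub>R S x \<partial>M) \<bullet> v) *\<^sub>R m
      - (v \<bullet> m) *\<^sub>R (\<integral>x. exp (z \<bullet> S x) *\<^sub>R S x \<partial>M) + partition_function z *\<^sub>R ((v \<bullet> m) *\<^sub>R m)"
  proof -
    have 1: "integrable M (\<lambda>x. (exp (z \<bullet> S x) *\<^sub>R S x \<bullet> v) *\<^sub>R m)"
      "integrable M (\<lambda>x. (v \<bullet> m) *\<^sub>R (exp (z \<bullet> S x) *\<^sub>R S x))"
      "integrable M (\<lambda>x. exp (z \<bullet> S x) *\<^sub>R ((v \<bullet> m) *\<^sub>R m))"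
      by (intro integrable_scaleR_left integrable_scaleR_right integrable_inner_left int)+
    have 2: "(\<integral>x. (exp (z \<bullet> S x) *\<^sub>R S x \<bullet> v) *\<^sub>R m \<partial>M) = ((\<integral>x. exp (z \<bullet> S x) *\<^sub>R S x \<partial>M) \<bullet> v) *\<^sub>R m"
      by (subst integral_scaleR_left, intro integrable_inner_left int) (subst integral_inner_left[OF int(1)], rule refl)
    have 3: "(\<integral>x. (v \<bullet> m) *\<^sub>R (exp (z \<bullet> S x) *\<^sub>R S x) \<partial>M) = (v \<bullet> m) *\<^sub>R (\<integral>x. exp (z \<bullet> S x) *\<^sub>R S x \<partial>M)"
      by (rule integral_scaleR_right)
    have 4: "(\<integral>x. exp (z \<bullet> S x) *\<^sub>R ((v \<bullet> m) *\<^sub>R m) \<partial>M) = partition_function z *\<^sub>R ((v \<bullet> m) *\<^sub>R m)"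
      by (rule integral_scaleR_left) (rule int(3))
    show ?thesis
      unfolding Bochner_Integration.integral_add[OF Bochner_Integration.integrable_diff[OF
            Bochner_Integration.integrable_diff[OF int(2) 1(1)] 1(2)] 1(3)]
        Bochner_Integration.integral_diff[OF Bochner_Integration.integrable_diff[OF int(2) 1(1)] 1(2)]
        Bochner_Integration.integral_diff[OF int(2) 1(1)] 2 3 4 ..
  qed
  finally show ?thesis
    unfolding tilted_cov_def m_def[symmetric] m
    using F by (simp add: scaleR_diff_right scaleR_add_right inner_commute)
qed

lemma has_derivative_log_partition:
  assumes "z \<in> interior (natural_params S M)"
  shows "(log_partition S M has_derivative (\<lambda>v. tilted_mean S M z \<bullet> v)) (at z)"
proof -
  note z = interior_subset[THEN subsetD, OF assms]
  have "((\<lambda>z. \<integral>x. exp (z \<bullet> S x) *\<^sub>R (1::real) \<partial>M) has_derivative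
          (\<lambda>v. \<integral>x. exp (z \<bullet> S x) *\<^sub>R ((v \<bullet> S x) *\<^sub>R 1) \<partial>M)) (at z)"
  proof (rule has_derivative_exp_integral[OF measurable_S _ assms])
    show "\<exists>C. \<forall>x. norm (1::real) \<le> C * exp (e * norm (S x))" if "0 < e" for e
      using that by (intro exI[of _ 1]) simp
  qed simp
  moreover have "(\<integral>x. exp (z \<bullet> S x) *\<^sub>R ((v \<bullet> S x) *\<^sub>R 1) \<partial>M) = (\<integral>x. exp (z \<bullet> S x) *\<^sub>R S x \<partial>M) \<bullet> v" for v
    unfolding integral_inner_left[OF integrable_moments(1)[OF assms], symmetric]
    by (simp add: inner_commute)
  ultimately have "(partition_function has_derivative
      (\<lambda>v. (\<integral>x. exp (z \<bullet> S x) *\<^sub>R S x \<partial>M) \<bullet> v)) (at z)" by simp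
  from has_derivative_ln[OF partition_function_pos[OF z] this]
  show ?thesis
    by (simp add: log_partition_def[abs_def] tilted_mean_def mult.commute divide_inverse)
qed

text \<open>The mean is the first moment times the reciprocal of the partition function. Writing
  that reciprocal as \<open>exp (- log_partition S M z)\<close> lets the product rule use the
  gradient just found.\<close>

lemma has_derivative_tilted_mean:
  assumes "z \<in> interior (natural_params S M)"
  shows "(tilted_mean S M has_derivative tilted_cov S M z) (at z)"
proof -
  note z = interior_subset[THEN subsetD, OF assms]
  have F: "partition_function z \<noteq> 0" using partition_function_pos[OF z] by simp
  have 1: "((\<lambda>z. \<integral>x. exp (z \<bullet> S x) *\<^sub>R S x \<partial>M) has_derivative
          (\<lambda>v. \<integral>x. exp (z \<bullet> S x) *\<^sub>R ((v \<bullet> S x) *\<^sub>R S x) \<partial>M)) (at z)"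
  proof (rule has_derivative_exp_integral[OF measurable_S _ assms])
    show "\<exists>C. \<forall>x. norm (S x) \<le> C * exp (e * norm (S x))" if "0 < e" for e
      using that le_exp_times[of "norm (S _)" e] by (intro exI[of _ "1/e"]) auto
  qed simp
  define U where "U = interior (natural_params S M)"
  have "((\<lambda>z. exp (- log_partition S M z)) has_derivative
      (\<lambda>v. exp (- log_partition S M z) * - (tilted_mean S M z \<bullet> v))) (at z)"
    by (auto intro!: derivative_eq_intros has_derivative_log_partition[OF assms])
  from has_derivative_scaleR[OF this 1]
  have "((\<lambda>z. exp (- log_partition S M z) *\<^sub>R (\<integral>x. exp (z \<bullet> S x) *\<^sub>R S x \<partial>M)) has_derivative
      (\<lambda>v. exp (- log_partition S M z) *\<^sub>R (\<integral>x. exp (z \<bullet> S x) *\<^sub>R ((v \<bullet> S x) *\<^sub>R S x) \<partial>M)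
        + (exp (- log_partition S M z) * - (tilted_mean S M z \<bullet> v)) *\<^sub>R (\<integral>x. exp (z \<bullet> S x) *\<^sub>R S x \<partial>M))) (at z)"
    by simp
  also have "(\<lambda>v. exp (- log_partition S M z) *\<^sub>R (\<integral>x. exp (z \<bullet> S x) *\<^sub>R ((v \<bullet> S x) *\<^sub>R S x) \<partial>M)
        + (exp (- log_partition S M z) * - (tilted_mean S M z \<bullet> v)) *\<^sub>R (\<integral>x. exp (z \<bullet> S x) *\<^sub>R S x \<partial>M))
      = tilted_cov S M z"
  proof
    fix v
    have "exp (- log_partition S M z) = inverse (partition_function z)"
      using partition_function_pos[OF z] by (simp add: log_partition_def exp_minus)
    moreover have "(\<integral>x. exp (z \<bullet> S x) *\<^sub>R S x \<partial>M) = partition_function z *\<^sub>R tilted_mean S M z"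
      using F by (simp add: tilted_mean_def)
    ultimately show "exp (- log_partition S M z) *\<^sub>R (\<integral>x. exp (z \<bullet> S x) *\<^sub>R ((v \<bullet> S x) *\<^sub>R S x) \<partial>M)
        + (exp (- log_partition S M z) * - (tilted_mean S M z \<bullet> v)) *\<^sub>R (\<integral>x. exp (z \<bullet> S x) *\<^sub>R S x \<partial>M)
      = tilted_cov S M z v"
      using F by (simp add: tilted_cov_eq[OF assms] inner_commute)
  qed
  \<comment> \<open>The product agrees with \<open>tilted_mean\<close> where the partition function
    is positive, in particular on the open set \<open>U\<close>.\<close>
  finally show ?thesis
  proof (rule has_derivative_transform_within_open[where s = U])
    show "open U" "z \<in> U" using assms by (auto simp: U_def)
    fix y assume "y \<in> U"
    then have "0 < partition_function y"
      using partition_function_pos interior_subset by (auto simp: U_def)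
    then show "exp (- log_partition S M y) *\<^sub>R (\<integral>x. exp (y \<bullet> S x) *\<^sub>R S x \<partial>M) = tilted_mean S M y"
      by (simp add: log_partition_def exp_minus tilted_mean_def)
  qed
qed

lemma inner_tilted_cov:
  assumes "z \<in> interior (natural_params S M)"
  shows "u \<bullet> tilted_cov S M z v =
    (\<integral>x. exp (z \<bullet> S x) * ((u \<bullet> (S x - tilted_mean S M z)) * (v \<bullet> (S x - tilted_mean S M z))) \<partial>M)
      / partition_function z"
  unfolding tilted_cov_def inner_scaleR_right integral_inner_right[OF integrable_cov[OF assms], symmetric]
  by (simp add: divide_inverse mult_ac)

lemma tilted_cov_symmetric:
  assumes "z \<in> interior (natural_params S M)"
  shows "u \<bullet> tilted_cov S M z v = v \<bullet> tilted_cov S M z u"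
  unfolding inner_tilted_cov[OF assms] by (simp add: mult_ac)

text \<open>The form is, up to a positive factor, the integral of a weighted square; if it vanished,
  \<open>u \<bullet> S x\<close> would equal its mean \<open>u \<bullet> m\<close> almost
  everywhere.\<close>

lemma tilted_cov_pos:
  assumes z: "z \<in> interior (natural_params S M)"
    and u: "\<not> (\<exists>c. AE x in M. u \<bullet> S x = c)"
  shows "0 < u \<bullet> tilted_cov S M z u"
proof -
  define m where "m = tilted_mean S M z"
  let ?f = "\<lambda>x. exp (z \<bullet> S x) * ((u \<bullet> (S x - m)) * (u \<bullet> (S x - m)))"
  have int: "integrable M ?f"
    using integrable_inner_right[OF integrable_cov[OF z, of u m], of u] by (simp add: mult_ac)
  have "\<not> (AE x in M. ?f x = 0)"
    using u[unfolded not_ex, rule_format, of "u \<bullet> m"] by (simp add: inner_diff_right)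
  then have "integral\<^sup>L M ?f \<noteq> 0"
    using integral_nonneg_eq_0_iff_AE[OF int] by (simp add: zero_le_mult_iff)
  moreover have "0 \<le> integral\<^sup>L M ?f" by (intro integral_nonneg_AE) simp
  ultimately have "0 < integral\<^sup>L M ?f" by linarith
  then show ?thesis
    using partition_function_pos[OF interior_subset[THEN subsetD, OF z]]
    unfolding inner_tilted_cov[OF z] m_def[symmetric] by simp
qed

end

section \<open>Kullback-Leibler divergence\<close>

text \<open>Integrability makes the positive and the negative part finite, so the extended
  difference is a difference of reals.\<close>

lemma kl_div_eq_integral:
  assumes int: "integrable M (\<lambda>x. f x * ln (f x / g x))"
  shows "kl_div M f g = ereal (\<integral>x. f x * ln (f x / g x) \<partial>M)"
proof -
  let ?h = "\<lambda>x. f x * ln (f x / g x)"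
  have fin: "(\<integral>\<^sup>+x. ennreal (?h x) \<partial>M) \<noteq> \<infinity>" "(\<integral>\<^sup>+x. ennreal (- ?h x) \<partial>M) \<noteq> \<infinity>"
    using int unfolding real_integrable_def by auto
  have "enn2ereal a = ereal (enn2real a)" if "a \<noteq> \<infinity>" for a
    using that by (cases a) auto
  then show ?thesis
    unfolding kl_div_def real_lebesgue_integral_def[OF int] using fin by simp
qed

text \<open>The integrand \<open>f * ln (f / g) - f + g\<close> is nonnegative and vanishes only where \<open>f = g\<close>. Its negative
  part being dominated by \<open>g\<close> also excludes that the value 0 arises from a difference of infinities.\<close>

lemma kl_div_separating:
  assumes pos: "\<And>x. 0 < f x" "\<And>x. 0 < g x"
    and int: "integrable M f" "integrable M g" and eq: "integral\<^sup>L M f = integral\<^sup>L M g"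
    and kl: "kl_div M f g = 0"
  shows "AE x in M. f x = g x"
proof -
  let ?h = "\<lambda>x. f x * ln (f x / g x)"
  have [measurable]: "f \<in> borel_measurable M" "g \<in> borel_measurable M" using int by auto
  have h: "f x - g x \<le> ?h x" for x
  proof -
    have "ln (g x / f x) \<le> g x / f x - 1" using pos by (intro ln_le_minus_one) auto
    then have "f x * ln (g x / f x) \<le> f x * (g x / f x - 1)"
      using pos[of x] by (intro mult_left_mono) auto
    then show ?thesis using pos(1)[of x] pos(2)[of x] by (simp add: ln_div algebra_simps)
  qed
  have "(\<integral>\<^sup>+x. ennreal (- ?h x) \<partial>M) \<le> (\<integral>\<^sup>+x. ennreal (g x) \<partial>M)"
  proof (intro nn_integral_mono ennreal_leI)
    fix x show "- ?h x \<le> g x" using h[of x] pos(1)[of x] by linarith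
  qed
  moreover have "(\<integral>\<^sup>+x. ennreal (g x) \<partial>M) \<noteq> \<infinity>"
    using int(2) unfolding real_integrable_def by simp
  ultimately have B: "(\<integral>\<^sup>+x. ennreal (- ?h x) \<partial>M) \<noteq> \<infinity>" by (auto simp: top_unique)
  \<comment> \<open>In \<open>ereal\<close> an infinite minuend gives an infinite difference
    whatever is subtracted, so the value 0 forces a finite positive part.\<close>
  have A: "(\<integral>\<^sup>+x. ennreal (?h x) \<partial>M) \<noteq> \<infinity>"
  proof
    assume "(\<integral>\<^sup>+x. ennreal (?h x) \<partial>M) = \<infinity>"
    with kl show False by (simp add: kl_div_def top_ereal_def)
  qed
  have hint: "integrable M ?h" unfolding real_integrable_def using A B by simp
  have h0: "integral\<^sup>L M ?h = 0" using kl kl_div_eq_integral[OF hint] by simp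
  have dint: "integrable M (\<lambda>x. ?h x - (f x - g x))"
    by (intro Bochner_Integration.integrable_diff hint int)
  have "integral\<^sup>L M (\<lambda>x. ?h x - (f x - g x)) = 0"
    using hint int h0 eq by simp
  then have "AE x in M. ?h x - (f x - g x) = 0"
    using integral_nonneg_eq_0_iff_AE[OF dint] h by simp
  then show ?thesis
  proof (rule AE_mp, intro AE_I2 impI)
    fix x assume "?h x - (f x - g x) = 0"
    then have "f x * ln (g x / f x) = g x - f x"
      using pos(1)[of x] pos(2)[of x] by (simp add: ln_div algebra_simps)
    then have "ln (g x / f x) = g x / f x - 1"
      using pos(1)[of x] by (simp add: field_simps)
    \<comment> \<open>Equality in \<open>ln t \<le> t - 1\<close> occurs only at
      \<open>t = 1\<close>.\<close>
    then have "g x / f x = 1" using pos by (intro ln_eq_minus_one) auto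
    then show "f x = g x" using pos(1)[of x] by simp
  qed
qed

section \<open>Divergence and Hessians within the exponential family\<close>

context exp_family
begin

lemma exp_density_eq:
  assumes "z \<in> natural_params S M"
  shows "exp_density S M z x = exp (z \<bullet> S x) / partition_function z"
  using partition_function_pos[OF assms] by (simp add: exp_density_def exp_diff log_partition_def)

lemma exp_density_integral:
  assumes "z \<in> natural_params S M"
  shows "integrable M (exp_density S M z)" "integral\<^sup>L M (exp_density S M z) = 1"
  unfolding exp_density_eq[OF assms, abs_def]
  using integrable_exp[OF assms] partition_function_pos[OF assms] by auto

text \<open>Vanishing divergence makes the densities agree almost everywhere, and logarithms leave a
  linear relation in \<open>S\<close>. Boundary parameters are covered, since only the integrals of
  the densities enter and no moment of \<open>S\<close>.\<close>

lemma kl_div_exp_density_separating: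
  assumes "z \<in> natural_params S M" "w \<in> natural_params S M"
    and "kl_div M (exp_density S M z) (exp_density S M w) = 0"
  shows "AE x in M. (z - w) \<bullet> S x = log_partition S M z - log_partition S M w"
proof -
  have "AE x in M. exp_density S M z x = exp_density S M w x"
    using assms by (intro kl_div_separating) (simp_all add: exp_density_integral, simp_all add: exp_density_def)
  then show ?thesis
    by (rule AE_mp) (auto simp: exp_density_def inner_diff_left)
qed

text \<open>The log-ratio of the densities is affine in \<open>S\<close>, so the divergence reduces
  to the first moment at \<open>z\<close>. The formula holds for every \<open>w\<close>, with
  whatever value \<open>log_partition S M w\<close> has.\<close>

lemma kl_div_exp_density:
  assumes z: "z \<in> interior (natural_params S M)"
  shows "kl_div M (exp_density S M z) (exp_density S M w) =
    ereal ((z - w) \<bullet> tilted_mean S M z - log_partition S M z + log_partition S M w)"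
proof -
  note zN = interior_subset[THEN subsetD, OF z]
  define k where "k = log_partition S M w - log_partition S M z"
  have F: "partition_function z \<noteq> 0" using partition_function_pos[OF zN] by simp
  have h: "exp_density S M z x * ln (exp_density S M z x / exp_density S M w x) =
      ((exp (z \<bullet> S x) *\<^sub>R S x) \<bullet> (z - w)) / partition_function z + exp_density S M z x * k" for x
  proof -
    have "ln (exp_density S M z x / exp_density S M w x) = (z - w) \<bullet> S x + k"
      by (simp add: exp_density_def k_def inner_diff_left flip: exp_diff)
    then show ?thesis
      by (simp add: exp_density_eq[OF zN] distrib_left inner_commute)
  qed
  have int: "integrable M (\<lambda>x. ((exp (z \<bullet> S x) *\<^sub>R S x) \<bullet> (z - w)) / partition_function z)"
      "integrable M (\<lambda>x. exp_density S M z x * k)"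
    by (intro integrable_divide integrable_inner_left integrable_mult_left integrable_moments z
        exp_density_integral zN)+
  have "kl_div M (exp_density S M z) (exp_density S M w) =
      ereal (\<integral>x. ((exp (z \<bullet> S x) *\<^sub>R S x) \<bullet> (z - w)) / partition_function z + exp_density S M z x * k \<partial>M)"
    using kl_div_eq_integral[of M "exp_density S M z" "exp_density S M w"]
      Bochner_Integration.integrable_add[OF int] unfolding h by blast
  also have "(\<integral>x. ((exp (z \<bullet> S x) *\<^sub>R S x) \<bullet> (z - w)) / partition_function z + exp_density S M z x * k \<partial>M)
      = (z - w) \<bullet> tilted_mean S M z + k"
  proof -
    have "(\<integral>x. ((exp (z \<bullet> S x) *\<^sub>R S x) \<bullet> (z - w)) / partition_function z \<partial>M)
        = (z - w) \<bullet> tilted_mean S M z"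
      unfolding integral_divide_zero integral_inner_left[OF integrable_moments(1)[OF z]] tilted_mean_def
      by (simp add: inner_commute divide_inverse mult.commute)
    moreover have "(\<integral>x. exp_density S M z x * k \<partial>M) = k"
      using exp_density_integral[OF zN] by simp
    ultimately show ?thesis by (simp only: Bochner_Integration.integral_add[OF int])
  qed
  finally show ?thesis by (simp add: k_def algebra_simps)
qed

text \<open>An affine summand shifts the gradient by the constant \<open>a\<close> and leaves the
  Hessian alone. This serves all three Hessians: \<open>a\<close> is \<open>t\<^sub>0\<close> for
  \<open>\<psi>\<^sub>y\<close>, 0 for \<open>\<psi>bar\<close>, and minus the tilted mean for the
  divergence.\<close>

lemma has_hessian_on_affine_plus_log_partition:
  assumes z: "z \<in> interior (natural_params S M)"
    and f: "\<And>w. w \<in> interior (natural_params S M) \<Longrightarrow> f w = a \<bullet> w + k + log_partition S M w"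
  shows "has_hessian_on W I b f (\<lambda>i j. b i \<bullet> tilted_cov S M z (b j)) z"
  unfolding has_hessian_on_def
proof (rule exI[of _ "\<lambda>w. a + tilted_mean S M w"], rule exI[of _ "tilted_cov S M z"], intro conjI ballI refl)
  let ?U = "interior (natural_params S M)"
  have "\<forall>\<^sub>F w in nhds z. w \<in> ?U"
    using z by (intro eventually_nhds_in_open) auto
  then show "\<forall>\<^sub>F w in nhds z. w \<in> W \<longrightarrow>
      (f has_derivative (\<lambda>v. (a + tilted_mean S M w) \<bullet> v)) (at w within W)"
  proof (rule eventually_mono, intro impI)
    fix w assume w: "w \<in> ?U"
    have "((\<lambda>w. a \<bullet> w + k + log_partition S M w) has_derivative
        (\<lambda>v. (a + tilted_mean S M w) \<bullet> v)) (at w)"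
      by (auto intro!: derivative_eq_intros has_derivative_log_partition[OF w] simp: inner_add_left)
    then have "(f has_derivative (\<lambda>v. (a + tilted_mean S M w) \<bullet> v)) (at w)"
      by (rule has_derivative_transform_within_open[where s = ?U]) (simp_all add: w f)
    then show "(f has_derivative (\<lambda>v. (a + tilted_mean S M w) \<bullet> v)) (at w within W)"
      by (rule has_derivative_at_withinI)
  qed
  have "((\<lambda>w. a + tilted_mean S M w) has_derivative tilted_cov S M z) (at z)"
    by (auto intro!: derivative_eq_intros has_derivative_tilted_mean[OF z])
  then show "((\<lambda>w. a + tilted_mean S M w) has_derivative tilted_cov S M z) (at z within W)"
    by (rule has_derivative_at_withinI)
qed

lemma linear_tilted_cov: "z \<in> interior (natural_params S M) \<Longrightarrow> linear (tilted_cov S M z)"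
  using has_derivative_tilted_mean by (blast intro: has_derivative_linear)

end

section \<open>Orthogonal projection and block decomposition\<close>

text \<open>Two candidates for the projection differ by a vector that lies in \<open>V\<close> and
  in its orthogonal complement, hence is orthogonal to itself. This justifies the definite
  description in \<open>orth_proj\<close>.\<close>

lemma orth_proj:
  assumes V: "subspace V"
  shows "orth_proj V x \<in> V" "x - orth_proj V x \<in> V\<^sup>\<bottom>"
    and orth_proj_unique: "\<And>v. v \<in> V \<Longrightarrow> x - v \<in> V\<^sup>\<bottom> \<Longrightarrow> orth_proj V x = v"
proof -
  have uniq: "v = w" if "v \<in> V" "x - v \<in> V\<^sup>\<bottom>" "w \<in> V" "x - w \<in> V\<^sup>\<bottom>" for v w
  proof -
    have "w - v \<in> V" using that V by (simp add: subspace_diff)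
    moreover have "(x - v) - (x - w) \<in> V\<^sup>\<bottom>"
      using that subspace_orthogonal_comp by (blast intro: subspace_diff)
    ultimately have "(w - v) \<bullet> (w - v) = 0"
      by (simp add: orthogonal_comp_def orthogonal_def)
    then show ?thesis by simp
  qed
  obtain v w where "v \<in> span V" "\<And>u. u \<in> span V \<Longrightarrow> orthogonal w u" "x = v + w"
    using orthogonal_subspace_decomp_exists by blast
  moreover have "span V = V" using V by simp
  ultimately have v: "v \<in> V" "x - v \<in> V\<^sup>\<bottom>"
    by (auto simp: orthogonal_comp_def orthogonal_commute)
  have "orth_proj V x \<in> V \<and> x - orth_proj V x \<in> V\<^sup>\<bottom>"
    unfolding orth_proj_def
    by (rule theI[of "\<lambda>v. v \<in> V \<and> x - v \<in> V\<^sup>\<bottom>" v]) (use v uniq in blast)+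
  then show *: "orth_proj V x \<in> V" "x - orth_proj V x \<in> V\<^sup>\<bottom>" by auto
  show "orth_proj V x = v" if "v \<in> V" "x - v \<in> V\<^sup>\<bottom>" for v
    using uniq that * by blast
qed

lemma orth_proj_id: "subspace V \<Longrightarrow> v \<in> V \<Longrightarrow> orth_proj V v = v"
  by (rule orth_proj_unique) (auto simp: subspace_0 subspace_orthogonal_comp)

lemma inner_orth_proj:
  assumes "subspace V" "u \<in> V"
  shows "u \<bullet> orth_proj V x = u \<bullet> x"
  using orth_proj(2)[OF assms(1), of x] assms(2)
  by (simp add: orthogonal_comp_def orthogonal_def inner_diff_right)

text \<open>Used to replace a parameter by its projection in the exponent of the reduced
  family.\<close>

lemma orth_proj_inner_orth_proj:
  assumes "subspace V"
  shows "orth_proj V x \<bullet> orth_proj V y = x \<bullet> orth_proj V y"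
  using inner_orth_proj[OF assms orth_proj(1)[OF assms], of y x] by (simp add: inner_commute)

lemma linear_orth_proj:
  assumes V: "subspace V"
  shows "linear (orth_proj V)"
proof (rule linearI)
  note V' = subspace_orthogonal_comp[of V]
  show "orth_proj V (x + y) = orth_proj V x + orth_proj V y" for x y
    using subspace_add[OF V orth_proj(1)[OF V, of x] orth_proj(1)[OF V, of y]]
      subspace_add[OF V' orth_proj(2)[OF V, of x] orth_proj(2)[OF V, of y]]
    by (intro orth_proj_unique[OF V]) (simp_all add: algebra_simps)
  show "orth_proj V (c *\<^sub>R x) = c *\<^sub>R orth_proj V x" for c x
    using subspace_scale[OF V orth_proj(1)[OF V, of x], of c]
      subspace_scale[OF V' orth_proj(2)[OF V, of x], of c]
    by (intro orth_proj_unique[OF V]) (simp_all add: algebra_simps)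
qed

lemma dim_orthogonal_comp:
  fixes V :: "'a::euclidean_space set"
  assumes "subspace V"
  shows "dim (V\<^sup>\<bottom>) + dim V = DIM('a)"
  using dim_subspace_orthogonal_to_vectors[of V UNIV] assms
  by (simp add: orthogonal_comp_def)

lemma orthonormal_coords_in: "orthonormal_coords V b \<Longrightarrow> i < dim V \<Longrightarrow> b i \<in> V"
  unfolding orthonormal_coords_def by (metis image_eqI lessThan_iff span_base)

text \<open>The matrix form at the coefficients \<open>u\<close> is \<open>w \<bullet> G w\<close>
  for the vector \<open>w\<close> of \<open>V\<close> with these coordinates, and \<open>w\<close>
  is nonzero because orthonormality recovers \<open>u k\<close> as
  \<open>w \<bullet> b k\<close>.\<close>

lemma pos_def_orthonormal_coords:
  fixes G :: "'a::euclidean_space \<Rightarrow> 'a"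
  assumes b: "orthonormal_coords V b" and V: "subspace V" and G: "linear G"
    and sym: "\<And>u v. u \<bullet> G v = v \<bullet> G u"
    and pos: "\<And>u. u \<in> V \<Longrightarrow> u \<noteq> 0 \<Longrightarrow> 0 < u \<bullet> G u"
  shows "pos_def (dim V) (\<lambda>i j. b i \<bullet> G (b j))"
  unfolding pos_def_def
proof (intro conjI allI impI)
  show "b i \<bullet> G (b j) = b j \<bullet> G (b i)" for i j by (rule sym)
  fix u :: "nat \<Rightarrow> real" assume "\<exists>i<dim V. u i \<noteq> 0"
  then obtain k where k: "k < dim V" "u k \<noteq> 0" by blast
  define w where "w = (\<Sum>i<dim V. u i *\<^sub>R b i)"
  have "w \<bullet> b k = (\<Sum>i<dim V. u i * (if i = k then 1 else 0))"
    unfolding w_def inner_sum_left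
    using b k by (intro sum.cong) (auto simp: orthonormal_coords_def)
  also have "\<dots> = u k" using k by (simp add: if_distrib[of "\<lambda>x. _ * x"] cong: if_cong)
  finally have "w \<noteq> 0" using k by auto
  moreover have "w \<in> V" unfolding w_def
    using V b by (intro subspace_sum subspace_scale) (auto simp: orthonormal_coords_in)
  ultimately have "0 < w \<bullet> G w" by (rule pos[rotated])
  also have "w \<bullet> G w = (\<Sum>j<dim V. \<Sum>i<dim V. u i * (b i \<bullet> G (b j)) * u j)"
    unfolding w_def
    by (simp add: linear_sum[OF G] linear_scale[OF G] inner_sum_left inner_sum_right sum_distrib_left mult_ac)
  also have "\<dots> = (\<Sum>i<dim V. \<Sum>j<dim V. u i * (b i \<bullet> G (b j)) * u j)"
    by (rule sum.swap)
  finally show "0 < (\<Sum>i<dim V. \<Sum>j<dim V. u i * (b i \<bullet> G (b j)) * u j)" .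
qed

text \<open>Positivity makes \<open>G\<close> injective on \<open>V\<close>, which bounds the rank
  from below; the range inside \<open>V\<close> bounds it from above.\<close>

lemma rank_matrix_eq_dim:
  fixes G :: "real^'n \<Rightarrow> real^'n"
  assumes V: "subspace V" and G: "linear G" and range: "\<And>v. G v \<in> V"
    and pos: "\<And>u. u \<in> V \<Longrightarrow> u \<noteq> 0 \<Longrightarrow> 0 < u \<bullet> G u"
  shows "rank (matrix G) = dim V"
proof -
  have "inj_on G (span V)"
    unfolding linear_inj_on_iff_eq_0[OF G subspace_span]
  proof (intro ballI impI)
    fix u assume "u \<in> span V" "G u = 0"
    moreover have "span V = V" using V by simp
    ultimately show "u = 0" using pos[of u] by auto
  qed
  then have "dim (G ` V) = dim V" by (rule dim_image_eq[OF G])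
  moreover have "dim (G ` V) \<le> dim (range G)" by (intro dim_subset) auto
  moreover have "dim (range G) \<le> dim V" using range by (intro dim_subset) auto
  moreover have "(*v) (matrix G) = G" using G by (simp add: fun_eq_iff matrix_works linear_matrix_vector_mul_eq)
  ultimately show ?thesis by (simp add: rank_dim_range)
qed

text \<open>The matrix \<open>Q\<close> of the theorem. Its rows are the basis vectors, so
  multiplying by it takes inner products with them, that is, passes to coordinates.\<close>

definition coord_change ::
  "('n \<Rightarrow> nat) \<Rightarrow> nat \<Rightarrow> (nat \<Rightarrow> real^'n) \<Rightarrow> (nat \<Rightarrow> real^'n) \<Rightarrow> real^'n^'n" where
  "coord_change r m b c = (\<chi> i. if r i < m then b (r i) else c (r i - m))"

context
  fixes V :: "(real^'n) set" and r :: "'n \<Rightarrow> nat" and b c :: "nat \<Rightarrow> real^'n"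
  assumes V: "subspace V" and r: "bij_betw r UNIV {..<CARD('n)}"
    and b: "orthonormal_coords V b" and c: "orthonormal_coords (V\<^sup>\<bottom>) c"
begin

text \<open>The dimensions of \<open>V\<close> and its complement add up to \<open>CARD('n)\<close>,
  so the positions beyond the first block index exactly the vectors of \<open>c\<close>.\<close>

lemma coord_index: "\<not> r i < dim V \<Longrightarrow> r i - dim V < dim (V\<^sup>\<bottom>)"
proof -
  assume "\<not> r i < dim V"
  moreover have "r i < CARD('n)" using r by (auto simp: bij_betw_def)
  ultimately show ?thesis using dim_orthogonal_comp[OF V] by simp
qed

lemma coord_change_row:
  "coord_change r (dim V) b c $ i \<in> (if r i < dim V then V else V\<^sup>\<bottom>)"
  using orthonormal_coords_in[OF b] orthonormal_coords_in[OF c] coord_index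
  by (simp add: coord_change_def)

lemma orthogonal_matrix_coord_change: "orthogonal_matrix (coord_change r (dim V) b c)"
proof -
  have "coord_change r (dim V) b c $ i \<bullet> coord_change r (dim V) b c $ j = (if i = j then 1 else 0)" for i j
  proof -
    have inj: "r i = r j \<longleftrightarrow> i = j" using r by (auto simp: bij_betw_def inj_on_def)
    have bc: "u \<bullet> v = 0" "v \<bullet> u = 0" if "u \<in> V" "v \<in> V\<^sup>\<bottom>" for u v
      using that by (auto simp: orthogonal_comp_def orthogonal_def inner_commute)
    show ?thesis
    proof (cases "r i < dim V"; cases "r j < dim V")
      assume "r i < dim V" "r j < dim V"
      then show ?thesis using b inj by (simp add: coord_change_def orthonormal_coords_def)
    next
      assume ij: "\<not> r i < dim V" "\<not> r j < dim V"
      \<comment> \<open>Both positions are at least \<open>dim V\<close>, so the subtraction of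
        naturals does not truncate.\<close>
      then have "r i - dim V = r j - dim V \<longleftrightarrow> i = j" using inj by auto
      then show ?thesis using c ij coord_index by (simp add: coord_change_def orthonormal_coords_def)
    qed (use coord_change_row[of i] coord_change_row[of j] bc in auto)
  qed
  then show ?thesis
    by (auto simp: orthogonal_matrix_orthonormal_rows row_def norm_eq_1 orthogonal_def)
qed

lemma coord_change_mult_vec:
  "coord_change r (dim V) b c *v x =
    block_vector r (dim V) (\<lambda>i. b i \<bullet> orth_proj V x) (\<lambda>i. c i \<bullet> (x - orth_proj V x))"
proof -
  have "c i \<bullet> orth_proj V x = 0" if "i < dim (V\<^sup>\<bottom>)" for i
    using orthonormal_coords_in[OF c that] orth_proj(1)[OF V, of x]
    by (auto simp: orthogonal_comp_def orthogonal_def inner_commute)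
  then show ?thesis
    using coord_index inner_orth_proj[OF V orthonormal_coords_in[OF b]]
    by (auto simp: vec_eq_iff matrix_vector_mul_component block_vector_def coord_change_def inner_diff_right)
qed

text \<open>Entry \<open>(i, j)\<close> is row \<open>i\<close> paired with the image of row
  \<open>j\<close>. It vanishes if row \<open>i\<close> is orthogonal to \<open>V\<close>, because
  \<open>G\<close> maps into \<open>V\<close>, and by symmetry also if row \<open>j\<close>
  is.\<close>

lemma coord_change_conjugate:
  assumes G: "linear G" and sym: "\<And>u v. u \<bullet> G v = v \<bullet> G u" and range: "\<And>v. G v \<in> V"
  shows "coord_change r (dim V) b c ** matrix G ** transpose (coord_change r (dim V) b c) =
    block_matrix r (dim V) (\<lambda>i j. b i \<bullet> G (b j))"
proof -
  let ?Q = "coord_change r (dim V) b c"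
  have entry: "(?Q ** matrix G ** transpose ?Q) $ i $ j = ?Q $ i \<bullet> G (?Q $ j)" for i j
  proof -
    have "(?Q ** matrix G ** transpose ?Q) $ i $ j = (?Q ** matrix G) $ i \<bullet> ?Q $ j"
      by (simp add: matrix_matrix_mult_def transpose_def inner_vec_def)
    also have "(?Q ** matrix G) $ i = ?Q $ i v* matrix G"
      by (simp add: vec_eq_iff matrix_matrix_mult_def vector_matrix_mult_def mult.commute)
    also have "(?Q $ i v* matrix G) \<bullet> ?Q $ j = ?Q $ i \<bullet> (matrix G *v ?Q $ j)"
      by (rule dot_lmul_matrix)
    also have "matrix G *v ?Q $ j = G (?Q $ j)" by (rule matrix_works) (simp add: G linear_matrix_vector_mul_eq)
    finally show ?thesis .
  qed
  have zero: "u \<bullet> G v = 0" "v \<bullet> G u = 0" if "u \<in> V\<^sup>\<bottom>" for u v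
    using that range[of v] sym[of v u] by (auto simp: orthogonal_comp_def orthogonal_def inner_commute)
  have eq: "?Q $ i \<bullet> G (?Q $ j) =
      (if r i < dim V \<and> r j < dim V then b (r i) \<bullet> G (b (r j)) else 0)" for i j
  proof (cases "r i < dim V \<and> r j < dim V")
    case True
    then show ?thesis by (simp add: coord_change_def)
  next
    case False
    then show ?thesis
      using zero(1)[of "?Q $ i" "?Q $ j"] zero(2)[of "?Q $ j" "?Q $ i"]
        coord_change_row[of i] coord_change_row[of j] by auto
  qed
  show ?thesis by (simp add: vec_eq_iff entry eq block_matrix_def)
qed

end

section \<open>Dimension reduction\<close>

theorem corollary1:
  fixes M :: "'x measure" and N :: "'y measure" and h :: "'x \<Rightarrow> 'y" and \<kappa> :: "'y \<Rightarrow> 'x measure"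
    and T :: "'x \<Rightarrow> real^'n" and y :: 'y and V :: "(real^'n) set" and t\<^sub>0 :: "real^'n"
    and r :: "'n \<Rightarrow> nat" and b c :: "nat \<Rightarrow> real^'n"
  defines "\<Theta> \<equiv> natural_params T M"
    and "P \<equiv> orth_proj V"
    and "m \<equiv> dim V"
  defines "\<psi>\<^sub>y \<equiv> log_partition T (\<kappa> y)"
    and "\<psi>bar \<equiv> log_partition (P \<circ> T) (\<kappa> y)"
    and "\<Theta>bar \<equiv> V \<inter> natural_params (P \<circ> T) (\<kappa> y)"
    and "K \<equiv> (\<lambda>\<theta> \<eta>. kl_div (\<kappa> y) (cond_density T M \<kappa> y \<theta>) (cond_density T M \<kappa> y \<eta>))"
    and "Kbar \<equiv> (\<lambda>\<theta> \<eta>. kl_div (\<kappa> y) (exp_density (P \<circ> T) (\<kappa> y) \<theta>) (exp_density (P \<circ> T) (\<kappa> y) \<eta>))"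
  assumes "sigma_finite_measure M"
    and "h \<in> measurable M N"
    and "disintegration M N h \<kappa>"
    and "T \<in> borel_measurable M"
    and "aff_dim \<Theta> = int CARD('n)"
    and "minimal_statistic T M"
    and "y \<in> space N"
    and "\<And>\<theta>. \<theta> \<in> \<Theta> \<Longrightarrow>
           integrable (\<kappa> y) (exp_density T M \<theta>) \<and> 0 < marginal_density T M \<kappa> y \<theta>"
    and "subspace V" and "t\<^sub>0 \<in> V\<^sup>\<bottom>"
    and "smallest_affine_support T (\<kappa> y) ((+) t\<^sub>0 ` V)"
    and "bij_betw r UNIV {..<CARD('n)}"
    and "orthonormal_coords V b" and "orthonormal_coords (V\<^sup>\<bottom>) c"
  shows "(\<exists>Q :: real^'n^'n. orthogonal_matrix Q \<and>
            (\<forall>\<theta>\<in>interior \<Theta>. \<exists>H Hbar.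
               has_hessian \<psi>\<^sub>y H \<theta> \<and>
               has_hessian_on V {..<m} b \<psi>bar Hbar (P \<theta>) \<and>
               Q ** H ** transpose Q = block_matrix r m Hbar \<and>
               Q *v \<theta> = block_vector r m (\<lambda>i. b i \<bullet> P \<theta>) (\<lambda>i. c i \<bullet> (\<theta> - P \<theta>)) \<and>
               pos_def m Hbar \<and>
               rank H = m)) \<and>
         (\<forall>\<theta>\<in>\<Theta>. \<forall>\<eta>\<in>\<Theta>. K \<theta> \<eta> = Kbar (P \<theta>) (P \<eta>)) \<and>
         P ` \<Theta> \<subseteq> \<Theta>bar \<and>
         (\<forall>\<theta>\<in>\<Theta>bar. \<forall>\<eta>\<in>\<Theta>bar. Kbar \<theta> \<eta> = 0 \<longrightarrow> \<theta> = \<eta>) \<and>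
         (\<forall>\<theta>\<in>interior \<Theta>. \<exists>H22.
            has_hessian_on V {..<m} b (\<lambda>\<eta>. real_of_ereal (Kbar (P \<theta>) \<eta>)) H22 (P \<theta>) \<and>
            pos_def m H22)"
proof -
  let ?\<nu> = "\<kappa> y"
  have V: "subspace V" and t0: "t\<^sub>0 \<in> V\<^sup>\<bottom>"
    and aff: "smallest_affine_support T ?\<nu> ((+) t\<^sub>0 ` V)" by fact+
  define S where "S = P \<circ> T"
  define N' where "N' = natural_params S ?\<nu>"
  have linP: "linear P" unfolding P_def by (rule linear_orth_proj[OF V])
  have sets: "sets ?\<nu> = sets M"
    using \<open>disintegration M N h \<kappa>\<close> \<open>y \<in> space N\<close> by (simp add: disintegration_def)
  have Tm[measurable]: "T \<in> borel_measurable ?\<nu>"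
    using \<open>T \<in> borel_measurable M\<close> measurable_cong_sets[OF sets refl] by blast
  have "P \<in> borel_measurable borel"
    using linP by (intro borel_measurable_continuous_onI linear_continuous_on)
      (simp add: linear_conv_bounded_linear)
  then have Sm[measurable]: "S \<in> borel_measurable ?\<nu>"
    unfolding S_def comp_def by (rule measurable_compose[OF Tm])
  \<comment> \<open>As \<open>t\<^sub>0\<close> is orthogonal to \<open>V\<close>, projecting
    \<open>t\<^sub>0 + v\<close> returns \<open>v\<close>.\<close>
  have T_eq: "AE x in ?\<nu>. T x = t\<^sub>0 + S x"
  proof -
    have "AE x in ?\<nu>. T x \<in> (+) t\<^sub>0 ` V" using aff by (simp add: smallest_affine_support_def)
    then show ?thesis
    proof (rule AE_mp, intro AE_I2 impI)
      fix x assume "T x \<in> (+) t\<^sub>0 ` V"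
      then obtain v where "v \<in> V" "T x = t\<^sub>0 + v" by blast
      then show "T x = t\<^sub>0 + S x" using orth_proj_unique[OF V, of v "T x"] t0 by (simp add: S_def P_def)
    qed
  qed
  have S_V: "S x \<in> V" for x unfolding S_def P_def comp_def by (rule orth_proj(1)[OF V])
  have inner_S: "P z \<bullet> S x = z \<bullet> S x" for z x
    unfolding S_def P_def comp_def by (rule orth_proj_inner_orth_proj[OF V])
  have expT: "AE x in ?\<nu>. exp (z \<bullet> T x) = exp (z \<bullet> t\<^sub>0) * exp (z \<bullet> S x)" for z
    using T_eq by (rule AE_mp) (simp add: inner_add_right exp_add)
  \<comment> \<open>The two tilts differ by the positive constant
    \<open>exp (z \<bullet> t\<^sub>0)\<close>.\<close>
  have natT: "natural_params T ?\<nu> = N'"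
  proof -
    have "integrable ?\<nu> (\<lambda>x. exp (z \<bullet> T x)) \<longleftrightarrow> integrable ?\<nu> (\<lambda>x. exp (z \<bullet> t\<^sub>0) * exp (z \<bullet> S x))" for z
      using expT by (intro integrable_cong_AE) measurable
    then show ?thesis unfolding N'_def by (auto simp: natural_params_iff_integrable Sm Tm)
  qed
  have \<Theta>: "integrable ?\<nu> (exp_density T M \<theta>) \<and> 0 < marginal_density T M \<kappa> y \<theta>" if "\<theta> \<in> \<Theta>" for \<theta>
    using that assms(16) by blast
  have dens: "exp_density T M \<theta> = (\<lambda>x. exp (- log_partition T M \<theta>) * exp (\<theta> \<bullet> T x))" for \<theta>
    by (simp add: fun_eq_iff exp_density_def flip: exp_add)
  have sub: "\<Theta> \<subseteq> N'"
    using \<Theta> unfolding natT[symmetric] by (auto simp: dens natural_params_iff_integrable Tm)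
  \<comment> \<open>The empty set has affine dimension -1. A single parameter with positive marginal
    density then shows that the fibre measure is not null.\<close>
  have "\<Theta> \<noteq> {}" using \<open>aff_dim \<Theta> = int CARD('n)\<close> by auto
  then obtain \<theta>0 where \<theta>0: "\<theta>0 \<in> \<Theta>" by blast
  interpret exp_family S ?\<nu>
  proof
    show "emeasure ?\<nu> (space ?\<nu>) \<noteq> 0"
    proof
      assume "emeasure ?\<nu> (space ?\<nu>) = 0"
      then have "AE x in ?\<nu>. exp_density T M \<theta>0 x = 0" by (intro AE_I[of _ _ "space ?\<nu>"]) auto
      then have "marginal_density T M \<kappa> y \<theta>0 = 0"
        unfolding marginal_density_def by (rule integral_eq_zero_AE)
      then show False using \<Theta>[OF \<theta>0] by simp
    qed
  qed (rule Sm)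
  have P_nat: "P z \<in> N' \<longleftrightarrow> z \<in> N'" for z
    by (simp add: N'_def natural_params_def inner_S)
  \<comment> \<open>\<open>N'\<close> is invariant under translations that \<open>P\<close>
    annihilates. Moving the interior of \<Theta> by \<open>P \<theta> - \<theta>\<close> therefore
    gives an open neighbourhood of \<open>P \<theta>\<close> inside \<open>N'\<close>.\<close>
  have P_int: "P \<theta> \<in> interior N'" if \<theta>: "\<theta> \<in> interior \<Theta>" for \<theta>
  proof (rule interiorI)
    show "open ((+) (P \<theta> - \<theta>) ` interior \<Theta>)" by (intro open_translation open_interior)
    show "P \<theta> \<in> (+) (P \<theta> - \<theta>) ` interior \<Theta>" using \<theta> by (intro image_eqI[of _ _ \<theta>]) auto
    have "P (P \<theta> - \<theta>) = 0"
      using orth_proj_id[OF V orth_proj(1)[OF V]] by (simp add: linear_diff[OF linP]) (simp add: P_def)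
    then have "P (P \<theta> - \<theta> + w) = P w" for w by (simp add: linear_add[OF linP])
    then have "P \<theta> - \<theta> + w \<in> N'" if "w \<in> N'" for w using that P_nat[of "P \<theta> - \<theta> + w"] P_nat[of w] by simp
    then show "(+) (P \<theta> - \<theta>) ` interior \<Theta> \<subseteq> N'" using sub interior_subset by blast
  qed
  have int_sub: "interior \<Theta> \<subseteq> interior N'" using sub by (rule interior_mono)
  have log_eq: "log_partition T ?\<nu> z = z \<bullet> t\<^sub>0 + log_partition S ?\<nu> z" if "z \<in> N'" for z
  proof -
    have "(\<integral>x. exp (z \<bullet> T x) \<partial>?\<nu>) = (\<integral>x. exp (z \<bullet> t\<^sub>0) * exp (z \<bullet> S x) \<partial>?\<nu>)"
      using expT by (intro integral_cong_AE) measurable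
    then show ?thesis
      using partition_function_pos[of z] that by (simp add: log_partition_def ln_mult N'_def)
  qed
  have log_P: "log_partition S ?\<nu> (P z) = log_partition S ?\<nu> z" for z
    by (simp add: log_partition_def inner_S)
  have cov_P: "tilted_cov S ?\<nu> (P z) = tilted_cov S ?\<nu> z" for z
    by (simp add: fun_eq_iff tilted_cov_def tilted_mean_def inner_S)
  have nonconst: "\<not> (\<exists>c. AE x in ?\<nu>. u \<bullet> S x = c)" if u: "u \<in> V" "u \<noteq> 0" for u
  proof
    assume "\<exists>c. AE x in ?\<nu>. u \<bullet> S x = c"
    then obtain k where k: "AE x in ?\<nu>. u \<bullet> S x = k" by blast
    have ut0: "u \<bullet> t\<^sub>0 = 0" using u t0 by (auto simp: orthogonal_comp_def orthogonal_def)
    have "AE x in ?\<nu>. T x \<in> {w. u \<bullet> w = k}"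
      using T_eq k by eventually_elim (simp add: inner_add_right ut0)
    moreover have "affine {w. u \<bullet> w = k}" by (rule affine_hyperplane)
    ultimately have "(+) t\<^sub>0 ` V \<subseteq> {w. u \<bullet> w = k}"
      using aff by (simp add: smallest_affine_support_def)
    \<comment> \<open>The points \<open>t\<^sub>0\<close> and \<open>t\<^sub>0 + u\<close> would lie
      on the same hyperplane, which forces \<open>u \<bullet> u = 0\<close>.\<close>
    then have "u \<bullet> (t\<^sub>0 + 0) = k" "u \<bullet> (t\<^sub>0 + u) = k" using u subspace_0[OF V] by blast+
    then show False using u by (simp add: inner_add_right)
  qed
  \<comment> \<open>A vector orthogonal to \<open>V\<close> annihilates \<open>S\<close>, hence its
    mean and covariance; the double complement of \<open>V\<close> is \<open>V\<close>.\<close>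
  have cov_V: "tilted_cov S ?\<nu> z v \<in> V" if z: "z \<in> interior N'" for z v
  proof -
    have "w \<bullet> tilted_cov S ?\<nu> z v = 0" if w: "w \<in> V\<^sup>\<bottom>" for w
    proof -
      have "w \<bullet> S x = 0" for x
        using w S_V[of x] by (auto simp: orthogonal_comp_def orthogonal_def inner_commute)
      moreover from this have "w \<bullet> tilted_mean S ?\<nu> z = 0"
        using integral_inner_right[OF integrable_moments(1)[OF z[unfolded N'_def]], of w]
        by (simp add: tilted_mean_def N'_def)
      ultimately show ?thesis
        using z inner_tilted_cov[of z w v] by (simp add: N'_def inner_diff_right)
    qed
    then have "tilted_cov S ?\<nu> z v \<in> V\<^sup>\<bottom>\<^sup>\<bottom>" by (simp add: orthogonal_comp_def orthogonal_def)
    then show ?thesis using orthogonal_comp_self[OF V] by simp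
  qed
  have cov: "linear (tilted_cov S ?\<nu> z)"
      "u \<bullet> tilted_cov S ?\<nu> z v = v \<bullet> tilted_cov S ?\<nu> z u"
      "u \<in> V \<Longrightarrow> u \<noteq> 0 \<Longrightarrow> 0 < u \<bullet> tilted_cov S ?\<nu> z u" if "z \<in> interior N'" for z u v
    using that linear_tilted_cov tilted_cov_symmetric tilted_cov_pos nonconst by (simp_all add: N'_def)
  define Hb where "Hb z = (\<lambda>i j. b i \<bullet> tilted_cov S ?\<nu> z (b j))" for z
  have pd: "pos_def m (Hb (P \<theta>))" if "\<theta> \<in> interior \<Theta>" for \<theta>
    unfolding Hb_def m_def using P_int[OF that] cov \<open>orthonormal_coords V b\<close> V
    by (intro pos_def_orthonormal_coords) auto
  have K_eq: "K \<theta> \<eta> = Kbar (P \<theta>) (P \<eta>)" if "\<theta> \<in> \<Theta>" "\<eta> \<in> \<Theta>" for \<theta> \<eta>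
  proof -
    \<comment> \<open>Numerator and marginal density share the factors
      \<open>exp (- log_partition T M z)\<close> and \<open>exp (z \<bullet> t\<^sub>0)\<close>,
      which cancel in the quotient.\<close>
    have cd: "AE x in ?\<nu>. cond_density T M \<kappa> y z x = exp_density S ?\<nu> (P z) x" if z: "z \<in> \<Theta>" for z
    proof -
      have pos: "0 < partition_function z" using sub z by (intro partition_function_pos) (auto simp: N'_def)
      have "(\<integral>x. exp (z \<bullet> T x) \<partial>?\<nu>) = (\<integral>x. exp (z \<bullet> t\<^sub>0) * exp (z \<bullet> S x) \<partial>?\<nu>)"
        using expT by (intro integral_cong_AE) measurable
      then have md: "marginal_density T M \<kappa> y z =
          exp (- log_partition T M z) * (exp (z \<bullet> t\<^sub>0) * partition_function z)"
        by (simp add: marginal_density_def dens)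
      have ed: "exp_density S ?\<nu> (P z) x = exp (z \<bullet> S x) / partition_function z" for x
        using sub z P_nat[of z] by (subst exp_density_eq) (auto simp: N'_def inner_S)
      show ?thesis using expT[of z]
        by (rule AE_mp) (simp add: cond_density_def md ed dens)
    qed
    have "AE x in ?\<nu>. cond_density T M \<kappa> y \<theta> x = exp_density S ?\<nu> (P \<theta>) x \<and>
        cond_density T M \<kappa> y \<eta> x = exp_density S ?\<nu> (P \<eta>) x"
      using cd[OF that(1)] cd[OF that(2)] by eventually_elim simp
    then show ?thesis
      unfolding K_def Kbar_def kl_div_def S_def[symmetric]
      by (intro arg_cong2[where f = minus] arg_cong[where f = enn2ereal] nn_integral_cong_AE;
          elim AE_mp) auto
  qed
  have P_sub: "P ` \<Theta> \<subseteq> \<Theta>bar"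
    using sub P_nat orth_proj(1)[OF V] by (auto simp: \<Theta>bar_def N'_def S_def P_def)
  have sep: "\<theta> = \<eta>" if "\<theta> \<in> \<Theta>bar" "\<eta> \<in> \<Theta>bar" "Kbar \<theta> \<eta> = 0" for \<theta> \<eta>
  proof (rule ccontr)
    assume "\<theta> \<noteq> \<eta>"
    \<comment> \<open>Both parameters lie in \<open>V\<close>, so their difference is a direction in
      which \<open>S\<close> is not constant.\<close>
    then have "\<not> (\<exists>c. AE x in ?\<nu>. (\<theta> - \<eta>) \<bullet> S x = c)"
      using that V by (intro nonconst) (auto simp: \<Theta>bar_def subspace_diff)
    moreover have "AE x in ?\<nu>. (\<theta> - \<eta>) \<bullet> S x = log_partition S ?\<nu> \<theta> - log_partition S ?\<nu> \<eta>"
      using that by (intro kl_div_exp_density_separating) (auto simp: \<Theta>bar_def Kbar_def S_def)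
    ultimately show False by blast
  qed
  have H22: "has_hessian_on V {..<m} b (\<lambda>\<eta>. real_of_ereal (Kbar (P \<theta>) \<eta>)) (Hb (P \<theta>)) (P \<theta>)"
    if "\<theta> \<in> interior \<Theta>" for \<theta>
    unfolding Hb_def
  proof (rule has_hessian_on_affine_plus_log_partition)
    let ?z = "P \<theta>"
    show z: "?z \<in> interior (natural_params S ?\<nu>)" using P_int[OF that] by (simp add: N'_def)
    \<comment> \<open>With the first argument fixed, the divergence is affine in \<open>w\<close>
      apart from \<open>log_partition S ?\<nu> w\<close>.\<close>
    show "real_of_ereal (Kbar ?z w) = - tilted_mean S ?\<nu> ?z \<bullet> w
        + (?z \<bullet> tilted_mean S ?\<nu> ?z - log_partition S ?\<nu> ?z) + log_partition S ?\<nu> w" for w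
      using kl_div_exp_density[OF z, of w]
      by (simp add: Kbar_def S_def[symmetric] inner_diff_left inner_commute)
  qed
  \<comment> \<open>Built from the bases alone, so the same matrix works for every \<theta>.\<close>
  define Q where "Q = coord_change r m b c"
  have blocks: "\<exists>H Hbar. has_hessian \<psi>\<^sub>y H \<theta> \<and> has_hessian_on V {..<m} b \<psi>bar Hbar (P \<theta>) \<and>
      Q ** H ** transpose Q = block_matrix r m Hbar \<and>
      Q *v \<theta> = block_vector r m (\<lambda>i. b i \<bullet> P \<theta>) (\<lambda>i. c i \<bullet> (\<theta> - P \<theta>)) \<and>
      pos_def m Hbar \<and> rank H = m" if \<theta>: "\<theta> \<in> interior \<Theta>" for \<theta>
  \<comment> \<open>By \<open>cov_P\<close> the covariance operators at \<theta> and at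
    \<open>P \<theta>\<close> coincide: the full Hessian is its matrix in standard coordinates, the
    reduced one its matrix in the basis \<open>b\<close>.\<close>
  proof (rule exI[of _ "matrix (tilted_cov S ?\<nu> \<theta>)"], rule exI[of _ "Hb (P \<theta>)"], intro conjI)
    note coords = V \<open>bij_betw r UNIV {..<CARD('n)}\<close> \<open>orthonormal_coords V b\<close> \<open>orthonormal_coords (V\<^sup>\<bottom>) c\<close>
    have \<theta>N: "\<theta> \<in> interior N'" using \<theta> int_sub by blast
    have "has_hessian_on UNIV UNIV (\<lambda>i. axis i 1) \<psi>\<^sub>y
        (\<lambda>i j. axis i 1 \<bullet> tilted_cov S ?\<nu> \<theta> (axis j 1)) \<theta>"
    proof (rule has_hessian_on_affine_plus_log_partition)
      show "\<theta> \<in> interior (natural_params S ?\<nu>)" using \<theta>N by (simp add: N'_def)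
      fix w assume "w \<in> interior (natural_params S ?\<nu>)"
      then have "w \<in> N'" using interior_subset by (auto simp: N'_def)
      then show "\<psi>\<^sub>y w = t\<^sub>0 \<bullet> w + 0 + log_partition S ?\<nu> w"
        using log_eq by (simp add: \<psi>\<^sub>y_def inner_commute)
    qed
    then show "has_hessian \<psi>\<^sub>y (matrix (tilted_cov S ?\<nu> \<theta>)) \<theta>"
      by (simp add: has_hessian_def matrix_def inner_axis')
    show "has_hessian_on V {..<m} b \<psi>bar (Hb (P \<theta>)) (P \<theta>)"
      unfolding Hb_def
    proof (rule has_hessian_on_affine_plus_log_partition)
      show "P \<theta> \<in> interior (natural_params S ?\<nu>)" using P_int[OF \<theta>] by (simp add: N'_def)
      show "\<psi>bar w = 0 \<bullet> w + 0 + log_partition S ?\<nu> w" for w by (simp add: \<psi>bar_def S_def)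
    qed
    show "Q ** matrix (tilted_cov S ?\<nu> \<theta>) ** transpose Q = block_matrix r m (Hb (P \<theta>))"
      unfolding Q_def m_def Hb_def cov_P
      by (rule coord_change_conjugate[OF coords]) (use cov cov_V \<theta>N in auto)
    show "Q *v \<theta> = block_vector r m (\<lambda>i. b i \<bullet> P \<theta>) (\<lambda>i. c i \<bullet> (\<theta> - P \<theta>))"
      unfolding Q_def m_def P_def by (rule coord_change_mult_vec[OF coords])
    show "pos_def m (Hb (P \<theta>))" by (rule pd[OF \<theta>])
    show "rank (matrix (tilted_cov S ?\<nu> \<theta>)) = m"
      unfolding m_def using \<theta>N cov cov_V V by (intro rank_matrix_eq_dim) auto
  qed
  have "orthogonal_matrix Q"
    unfolding Q_def m_def
    by (rule orthogonal_matrix_coord_change) fact+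
  then show ?thesis
    using blocks K_eq P_sub sep H22 pd by blast
qed

end
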